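(* Let $M,C,K\in\mathbb C^{n\times n}$ be Hermitian with $M,K$ nonsingular, and let $\widetilde M=M+\delta M$, $\widetilde C=C+\delta C$, $\widetilde K=K+\delta K$ be Hermitian with $\widetilde M,\widetilde K$ nonsingular. Let $$A=\begin{bmatrix}-K&0\\ 0&M\end{bmatrix},\ B=\begin{bmatrix}C&M\\ M&0\end{bmatrix},\qquad \widetilde A=\begin{bmatrix}-\widetilde K&0\\ 0&\widetilde M\end{bmatrix},\ \widetilde B=\begin{bmatrix}\widetilde C&\widetilde M\\ \widetilde M&0\end{bmatrix}$$ be the linearized Hermitian pairs of the quadratic eigenvalue problems $(\lambda^2M+\lambda C+K)x=0$ and $(\widetilde\lambda^2\widetilde M+\widetilde\lambda\widetilde C+\widetilde K)\widetilde x=0$, and put $\delta B=\widetilde B-B$. Let $X=[X_1\ \cdots\ X_m]$ and $\widetilde X=[\widetilde X_1\ \cdots\ \widetilde X_{\widetilde m}]$ be nonsingular matrices such that $X^H(A,B)X=\bigoplus_{j=1}^m(\Lambda_j,\Omega_j)$, where each $(\Lambda_j,\Omega_j)$ is a canonical block (types R1--R4 of the context) with corresponding eigenvalue $\lambda_j$, of size $n_j$ if $\lambda_j$ is real and $2n_j$ if $\lambda_j$ is non-real, and analogously $\widetilde X^H(\widetilde A,\widetilde B)\widetilde X=\bigoplus_{\widetilde j=1}^{\widetilde m}(\widetilde\Lambda_{\widetilde j},\widetilde\Omega_{\widetilde j})$ with corresponding $\widetilde n_{\widetilde j},\widetilde\lambda_{\widetilde j}$. Let $\lambda\in\lambda(\Lambda_j,\Omega_j)$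 and $\widetilde\lambda\in\lambda(\widetilde\Lambda_{\widetilde j},\widetilde\Omega_{\widetilde j})$ be nonzero eigenvalues lying in the closed upper half plane, write $X_\lambda=X_j$, $\widetilde X_{\widetilde\lambda}=\widetilde X_{\widetilde j}$, and put $\gamma=\left|\frac{\widetilde\lambda-\lambda}{\lambda}\right|$, $\widetilde\gamma=\left|\frac{\widetilde\lambda-\lambda}{\widetilde\lambda}\right|$. Then: 1. Suppose $n_j=\widetilde n_{\widetilde j}=1$, and write the eigenvectors (columns of $X_j$ and $\widetilde X_{\widetilde j}$) of the two pairs corresponding to $\lambda$ and $\widetilde\lambda$ as $u=\begin{bmatrix}x\\ \lambda x\end{bmatrix}$ and $\widetilde u=\begin{bmatrix}\widetilde x\\ \widetilde\lambda\widetilde x\end{bmatrix}$, where $x,\widetilde x$ are eigenvectors of the two quadratic eigenvalue problems. Suppose that $|u^HB\widetilde u|>\|X^{-1}\|_2\|\widetilde X\|_2\|B^{-1}\delta B\|_2$. Then $$\gamma\le\frac{\|X^{-1}\|_2\|\widetilde X\|_2(\delta a+\delta b+\delta c)}{\delta d-\|X^{-1}\|_2\|\widetilde X\|_2(\delta b+\delta c)},$$ where $$\delta a=\max\{\|K^{-1}\delta K\|_2,\|M^{-1}\delta M\|_2\},\quad \delta b=\|M^{-1}\delta M\|_2,\quad \delta c=\|M^{-1}\delta C\|_2+\|M^{-1}CM^{-1}\delta M\|_2,$$ $$\delta d=\left|x^HC\widetilde x+(\widetilde\lambda+\overline\lambda)x^HM\widetilde x\right|.$$ 2. If $\gamma\le\frac{5-\sqrt{17}}4$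 and $\widetilde\gamma\le\frac{5-\sqrt{17}}4$, then $$\frac{\gamma^{n_j}\,\widetilde\gamma^{\widetilde n_{\widetilde j}}}{\sqrt{\gamma^2+\widetilde\gamma^2}}\le2\,\frac{\|X^{-1}\|_2\|\widetilde X\|_2}{\|X_\lambda^HB\widetilde X_{\widetilde\lambda}\|_F}\sqrt{\tbinom{\widetilde n_{\widetilde j}+n_j-1}{n_j}^2\delta a_F^2+\tbinom{\widetilde n_{\widetilde j}+n_j-1}{\widetilde n_{\widetilde j}}^2\delta b_F^2},$$ where $$\delta a_F=\sqrt{\|K^{-1}\delta K\|_F^2+\|M^{-1}\delta M\|_F^2},\qquad \delta b_F=\sqrt{2\|M^{-1}\delta M\|_F^2+\|M^{-1}\delta C-M^{-1}CM^{-1}\delta M\|_F^2}.$$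
   Context: Notation: $\|\cdot\|_2$, $\|\cdot\|_F$ are the spectral and Frobenius norms; $A^H$ is the conjugate transpose; $\lambda(A,B)$ is the set of eigenvalues of the pair $A-\lambda B$. $X^H(A,B)X:=(X^HAX,X^HBX)$, and $\bigoplus$ denotes block diagonal direct sums of pairs. The inequality in item 2 is understood where both sides are defined, i.e. for $\lambda\ne\widetilde\lambda$ and $X_\lambda^HB\widetilde X_{\widetilde\lambda}\ne0$. Canonical blocks. $F_m$ is the $m\times m$ matrix with $(F_m)_{ij}=1$ if $i+j=m+1$ and $0$ otherwise; $G_m$ is the $m\times m$ matrix with $(G_m)_{ij}=1$ if $i+j=m$ and $0$ otherwise. The block types are: R1: $\delta(F_k,G_k)$, $\delta\in\{\pm1\}$ (eigenvalue $\infty$; cannot occur when $B$ is nonsingular); R2: $\eta'(G_\ell,F_\ell)$, $\eta'\in\{\pm1\}$ (eigenvalue $0$); R3: $\eta(\alpha F_\ell+|\alpha|G_\ell,F_\ell)$, $\eta\in\{\pm1\}$, $\alpha\in\mathbb R\setminus\{0\}$ (eigenvalue $\alpha$); R4: $\left(\begin{bmatrix}0&\beta F_m+|\beta|G_m\\ \overline\beta F_m+|\beta|G_m&0\end{bmatrix},F_{2m}\right)$, $\beta\in\mathbb C\setminus\mathbb R$ (eigenvalues $\beta,\overline\beta$).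
   Formalization: Item 1 is stated only where its denominator δd − ‖X⁻¹‖₂‖X̃‖₂(δb+δc) is positive; the printed hypothesis on |u^H B ũ| does not ensure this, and where the denominator is negative the printed inequality is false. *)

theory Defs
  imports "Jordan_Normal_Form.Gauss_Jordan_Elimination"
    "Jordan_Normal_Form.Schur_Decomposition" "HOL-Analysis.L2_Norm"
begin

definition hermitian_mat :: "complex mat \<Rightarrow> bool" where
  "hermitian_mat A \<longleftrightarrow> square_mat A \<and> mat_adjoint A = A"

text \<open>Only meaningful for invertible matrices; there \<^const>\<open>mat_inverse\<close> returns \<^const>\<open>Some\<close>.\<close>

definition mat_inv :: "complex mat \<Rightarrow> complex mat" where
  "mat_inv A = the (mat_inverse A)"

definition vec_norm2 :: "complex vec \<Rightarrow> real" where
  "vec_norm2 v = L2_set (\<lambda>i. cmod (v $ i)) {..<dim_vec v}"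

text \<open>The supremum ranges over the closed unit ball rather than the unit sphere, so that it
  is taken over a nonempty set also for matrices without columns.\<close>

definition spectral_norm :: "complex mat \<Rightarrow> real" where
  "spectral_norm A = (SUP v \<in> {v \<in> carrier_vec (dim_col A). vec_norm2 v \<le> 1}. vec_norm2 (A *\<^sub>v v))"

definition frobenius_norm :: "complex mat \<Rightarrow> real" where
  "frobenius_norm A =
     L2_set (\<lambda>(i, j). cmod (A $$ (i, j))) ({..<dim_row A} \<times> {..<dim_col A})"

definition pair_eigenvector :: "complex mat \<Rightarrow> complex mat \<Rightarrow> complex vec \<Rightarrow> complex \<Rightarrow> bool" where
  "pair_eigenvector A B v \<mu> \<longleftrightarrow>
     v \<in> carrier_vec (dim_col A) \<and> v \<noteq> 0\<^sub>v (dim_col A) \<and> A *\<^sub>v v = \<mu> \<cdot>\<^sub>v (B *\<^sub>v v)"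

text \<open>The finite eigenvalues of the pencil; the eigenvalue at infinity is not represented.\<close>

definition pair_eigenvalues :: "complex mat \<Rightarrow> complex mat \<Rightarrow> complex set" where
  "pair_eigenvalues A B = {\<mu>. \<exists>v. pair_eigenvector A B v \<mu>}"

definition qep_eigenvector ::
  "complex mat \<Rightarrow> complex mat \<Rightarrow> complex mat \<Rightarrow> complex vec \<Rightarrow> complex \<Rightarrow> bool" where
  "qep_eigenvector M C K x \<mu> \<longleftrightarrow>
     x \<in> carrier_vec (dim_col M) \<and> x \<noteq> 0\<^sub>v (dim_col M) \<and>
     (\<mu>\<^sup>2 \<cdot>\<^sub>m M + \<mu> \<cdot>\<^sub>m C + K) *\<^sub>v x = 0\<^sub>v (dim_row M)"

text \<open>Indices are 0-based: the 1-based conditions \<open>i + j = m + 1\<close> and \<open>i + j = m\<close> become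
  \<open>i + j + 1 = m\<close> and \<open>i + j + 2 = m\<close>.\<close>

definition F_mat :: "nat \<Rightarrow> complex mat" where
  "F_mat m = mat m m (\<lambda>(i, j). if i + j + 1 = m then 1 else 0)"

definition G_mat :: "nat \<Rightarrow> complex mat" where
  "G_mat m = mat m m (\<lambda>(i, j). if i + j + 2 = m then 1 else 0)"

datatype canonical_block =
    R1 (sign: real) (index: nat)
  | R2 (sign: real) (index: nat)
  | R3 (sign: real) (index: nat) (real_eigenvalue: real)
  | R4 (index: nat) (nonreal_eigenvalue: complex)

fun block_wf :: "canonical_block \<Rightarrow> bool" where
  "block_wf (R1 \<delta> k) \<longleftrightarrow> \<delta> \<in> {1, -1} \<and> 1 \<le> k"
| "block_wf (R2 \<eta> l) \<longleftrightarrow> \<eta> \<in> {1, -1} \<and> 1 \<le> l"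
| "block_wf (R3 \<eta> l \<alpha>) \<longleftrightarrow> \<eta> \<in> {1, -1} \<and> 1 \<le> l \<and> \<alpha> \<noteq> 0"
| "block_wf (R4 m \<beta>) \<longleftrightarrow> 1 \<le> m \<and> \<beta> \<notin> \<real>"

text \<open>The selector \<^const>\<open>index\<close> is the number \<open>n\<^sub>j\<close>: the block size for a real (or infinite)
  eigenvalue and half the block size for a nonreal one.\<close>

fun block_size :: "canonical_block \<Rightarrow> nat" where
  "block_size (R1 \<delta> k) = k"
| "block_size (R2 \<eta> l) = l"
| "block_size (R3 \<eta> l \<alpha>) = l"
| "block_size (R4 m \<beta>) = 2 * m"

fun block_Lambda :: "canonical_block \<Rightarrow> complex mat" where
  "block_Lambda (R1 \<delta> k) = of_real \<delta> \<cdot>\<^sub>m F_mat k"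
| "block_Lambda (R2 \<eta> l) = of_real \<eta> \<cdot>\<^sub>m G_mat l"
| "block_Lambda (R3 \<eta> l \<alpha>) =
     of_real \<eta> \<cdot>\<^sub>m (of_real \<alpha> \<cdot>\<^sub>m F_mat l + of_real \<bar>\<alpha>\<bar> \<cdot>\<^sub>m G_mat l)"
| "block_Lambda (R4 m \<beta>) =
     four_block_mat
       (0\<^sub>m m m) (\<beta> \<cdot>\<^sub>m F_mat m + of_real (cmod \<beta>) \<cdot>\<^sub>m G_mat m)
       (cnj \<beta> \<cdot>\<^sub>m F_mat m + of_real (cmod \<beta>) \<cdot>\<^sub>m G_mat m) (0\<^sub>m m m)"

fun block_Omega :: "canonical_block \<Rightarrow> complex mat" where
  "block_Omega (R1 \<delta> k) = of_real \<delta> \<cdot>\<^sub>m G_mat k"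
| "block_Omega (R2 \<eta> l) = of_real \<eta> \<cdot>\<^sub>m F_mat l"
| "block_Omega (R3 \<eta> l \<alpha>) = of_real \<eta> \<cdot>\<^sub>m F_mat l"
| "block_Omega (R4 m \<beta>) = F_mat (2 * m)"

definition hcat :: "nat \<Rightarrow> complex mat list \<Rightarrow> complex mat" where
  "hcat N Xs = mat_of_cols N (concat (map cols Xs))"

text \<open>\<open>X = [X\<^sub>1 \<dots> X\<^sub>m]\<close> is partitioned conformally with the blocks and transforms the pair
  of \<open>N \<times> N\<close> matrices \<open>(A, B)\<close> by congruence to their direct sum.\<close>

definition canonical_decomposition ::
  "nat \<Rightarrow> complex mat \<Rightarrow> complex mat \<Rightarrow> complex mat \<Rightarrow> complex mat list \<Rightarrow> canonical_block list \<Rightarrow> bool" where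
  "canonical_decomposition N A B X Xs bs \<longleftrightarrow>
     length Xs = length bs \<and>
     (\<forall>j < length bs. block_wf (bs ! j) \<and> Xs ! j \<in> carrier_mat N (block_size (bs ! j))) \<and>
     X = hcat N Xs \<and> X \<in> carrier_mat N N \<and> invertible_mat X \<and>
     mat_adjoint X * A * X = diag_block_mat (map block_Lambda bs) \<and>
     mat_adjoint X * B * X = diag_block_mat (map block_Omega bs)"

end

(* Both pairs are compared through the eigenblocks X_j and Xt_jt: the canonical form gives
   A X_j = B X_j J and At Xt_jt = Bt Xt_jt Jt with lower bidiagonal J, Jt. Since
   At - A = A W_A and Bt - B = B W_B, where W_A and W_B contain exactly the matrices that occur in
   the bounds, Y = X_j^H B Xt_jt satisfies the Sylvester equation Y Jt - J^H Y = J^H P - Q Jt with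
   P = X_j^H B W_A Xt_jt and Q = X_j^H B W_B Xt_jt. As X_j^H B consists of rows of X^-1 up to signs
   and order, P and Q are bounded by ||X^-1||_2 ||Xt||_2 times the norms of W_A and W_B.
   For part 1 one evaluates the two forms at a single pair of eigenvectors; for part 2 the
   Sylvester equation is solved entry by entry, which produces the binomial coefficients through
   Pascal's rule. *)

theory Submission
  imports Defs
begin

section \<open>Norms\<close>

text \<open>Non-real eigenvalues dictate the shape. A block of type R4 carries an eigenvalue and its
  conjugate at once, so X_j does not belong to \<open>l\<close> alone. As J and Jt are block
  diagonal, the Sylvester equation splits into up to four independent ones, and every eigenvalue
  difference in them is the distance between \<open>l\<close> or its conjugate and \<open>lt\<close>
  or its conjugate. Both eigenvalues lie in the closed upper half plane, which makes |lt - l| the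
  least of these distances, so one gap serves all four. The subdiagonal entries of J and Jt have the
  moduli of the eigenvalues; division by the gap therefore leaves only the ratios 1 / \<gamma> and 1
  / \<gamma>t. Each step away from the last row and column multiplies by such a ratio, and the
  binomial coefficients count the ways to get there. The factor 2 of the second bound and its
  smallness condition belong together: the condition yields \<gamma>, \<gamma>t \<le> 1/3, and once
  both ratios are at least 3, twice the homogeneous solution also absorbs the sources P and Q. W_A
  and W_B play the role of the inverses of A and B times the perturbations, which is why all errors
  are measured relative to M and K.\<close>

lemma dim_mat_adjoint [simp]:
  "dim_row (mat_adjoint A) = dim_col A" "dim_col (mat_adjoint A) = dim_row A"
  unfolding mat_adjoint_def by auto

lemma mat_adjoint_carrier [simp, intro]:
  "A \<in> carrier_mat r c \<Longrightarrow> mat_adjoint A \<in> carrier_mat c r"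
  by auto

lemma index_mat_adjoint [simp]:
  fixes A :: "complex mat"
  assumes "i < dim_col A" "j < dim_row A"
  shows "mat_adjoint A $$ (i, j) = cnj (A $$ (j, i))"
  using assms unfolding mat_adjoint_def by (simp add: mat_of_rows_index)

lemma mat_adjoint_adjoint [simp]: "mat_adjoint (mat_adjoint A) = (A :: complex mat)"
  by (rule eq_matI) auto

lemma mat_adjoint_mult:
  fixes A B :: "complex mat"
  assumes "A \<in> carrier_mat r k" "B \<in> carrier_mat k c"
  shows "mat_adjoint (A * B) = mat_adjoint B * mat_adjoint A"
  using assms by (intro eq_matI) (auto simp: scalar_prod_def mult.commute)

lemma mat_adjoint_one [simp]: "mat_adjoint (1\<^sub>m k) = (1\<^sub>m k :: complex mat)"
  by (rule eq_matI) auto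

text \<open>The product \<open>\<bullet>c\<close> conjugates its second argument, so a form u^H A v
  appears throughout as \<open>(A *\<^sub>v v) \<bullet>c u\<close>.\<close>

lemma cscalar_prod_adjoint:
  fixes A :: "complex mat"
  assumes A: "A \<in> carrier_mat r c" and v: "v \<in> carrier_vec c" and w: "w \<in> carrier_vec r"
  shows "(A *\<^sub>v v) \<bullet>c w = v \<bullet>c (mat_adjoint A *\<^sub>v w)"
proof -
  have "(A *\<^sub>v v) \<bullet>c w = (\<Sum>i<r. \<Sum>k<c. A $$ (i, k) * v $ k * cnj (w $ i))"
    using assms by (simp add: scalar_prod_def lessThan_atLeast0 sum_distrib_right)
  also have "\<dots> = (\<Sum>k<c. \<Sum>i<r. A $$ (i, k) * v $ k * cnj (w $ i))"
    by (rule sum.swap)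
  also have "\<dots> = v \<bullet>c (mat_adjoint A *\<^sub>v w)"
    using assms by (simp add: scalar_prod_def lessThan_atLeast0 sum_distrib_left mult_ac)
  finally show ?thesis .
qed

section \<open>The Euclidean norm of complex vectors\<close>

lemma vec_norm2_nonneg [simp]: "0 \<le> vec_norm2 v"
  unfolding vec_norm2_def by simp

lemma vec_norm2_power2: "(vec_norm2 v)\<^sup>2 = (\<Sum>i<dim_vec v. (cmod (v $ i))\<^sup>2)"
  unfolding vec_norm2_def L2_set_def by (simp add: sum_nonneg)

lemma vec_norm2_eq_0: "vec_norm2 v = 0 \<longleftrightarrow> v = 0\<^sub>v (dim_vec v)"
  proof
  assume "vec_norm2 v = 0"
  then show "v = 0\<^sub>v (dim_vec v)"
    unfolding vec_norm2_def by (intro eq_vecI) (auto simp: L2_set_eq_0_iff)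
next
  assume v: "v = 0\<^sub>v (dim_vec v)"
  have "v $ i = 0" if "i < dim_vec v" for i
    by (subst v) (use that in simp)
  then show "vec_norm2 v = 0"
    unfolding vec_norm2_def by (simp add: L2_set_eq_0_iff)
qed

lemma vec_norm2_zero [simp]: "vec_norm2 (0\<^sub>v k) = 0"
  by (simp add: vec_norm2_eq_0)

lemma vec_norm2_smult: "vec_norm2 (a \<cdot>\<^sub>v v) = cmod a * vec_norm2 v"
  unfolding vec_norm2_def
  by (subst L2_set_right_distrib) (auto simp: norm_mult intro!: L2_set_cong)

lemma vec_norm2_triangle:
  assumes "v \<in> carrier_vec k" "w \<in> carrier_vec k"
  shows "vec_norm2 (v + w) \<le> vec_norm2 v + vec_norm2 w"
proof -
  have "vec_norm2 (v + w) \<le> L2_set (\<lambda>i. cmod (v $ i) + cmod (w $ i)) {..<k}"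
    using assms unfolding vec_norm2_def by (auto intro!: L2_set_mono norm_triangle_ineq)
  also have "\<dots> \<le> vec_norm2 v + vec_norm2 w"
    using assms unfolding vec_norm2_def by (auto intro: L2_set_triangle_ineq)
  finally show ?thesis .
qed

lemma cscalar_prod_self: "v \<bullet>c v = complex_of_real ((vec_norm2 v)\<^sup>2)"
  unfolding vec_norm2_power2 scalar_prod_def
  by (simp add: lessThan_atLeast0 complex_mult_cnj cmod_power2)

lemma Cauchy_Schwarz_vec:
  fixes v w :: "complex vec"
  assumes "v \<in> carrier_vec k" "w \<in> carrier_vec k"
  shows "cmod (v \<bullet>c w) \<le> vec_norm2 v * vec_norm2 w"
proof -
  have "cmod (v \<bullet>c w) \<le> (\<Sum>i<k. \<bar>cmod (v $ i)\<bar> * \<bar>cmod (w $ i)\<bar>)"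
    using assms by (auto simp: scalar_prod_def lessThan_atLeast0 norm_mult
        intro!: order.trans[OF norm_sum])
  also have "\<dots> \<le> vec_norm2 v * vec_norm2 w"
    using assms L2_set_mult_ineq[of "\<lambda>i. cmod (v $ i)" "\<lambda>i. cmod (w $ i)" "{..<k}"]
    unfolding vec_norm2_def by auto
  finally show ?thesis .
qed

lemma sum_lessThan_add:
  fixes f :: "nat \<Rightarrow> 'a :: comm_monoid_add"
  shows "sum f {..<m + k} = sum f {..<m} + (\<Sum>i<k. f (m + i))"
  by (induction k) (auto simp: add_ac)

lemma vec_norm2_append_power2:
  "(vec_norm2 (v @\<^sub>v w))\<^sup>2 = (vec_norm2 v)\<^sup>2 + (vec_norm2 w)\<^sup>2"
by (simp add: vec_norm2_power2 sum_lessThan_add)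

section \<open>Frobenius and spectral norms and their product rules\<close>

lemma frobenius_norm_nonneg [simp]: "0 \<le> frobenius_norm A"
  unfolding frobenius_norm_def by simp

lemma frobenius_norm_power2:
  "(frobenius_norm A)\<^sup>2 = (\<Sum>i<dim_row A. \<Sum>k<dim_col A. (cmod (A $$ (i, k)))\<^sup>2)"
  unfolding frobenius_norm_def L2_set_def
  by (simp add: sum_nonneg sum.cartesian_product case_prod_unfold)

lemma frobenius_norm_cols:
  "(frobenius_norm A)\<^sup>2 = (\<Sum>k<dim_col A. (vec_norm2 (col A k))\<^sup>2)"
  unfolding frobenius_norm_power2 vec_norm2_power2 by (subst sum.swap) simp

lemma frobenius_norm_adjoint [simp]: "frobenius_norm (mat_adjoint A) = frobenius_norm A"
proof -
  have "(frobenius_norm (mat_adjoint A))\<^sup>2 = (frobenius_norm A)\<^sup>2"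
    unfolding frobenius_norm_power2 by (subst sum.swap) simp
  then show ?thesis by simp
qed

text \<open>Cauchy-Schwarz in each row. The purpose is an explicit bound showing that the supremum
  behind \<open>spectral_norm\<close> is finite.\<close>

lemma vec_norm2_mult_frobenius:
  assumes A: "A \<in> carrier_mat r c" and v: "v \<in> carrier_vec c"
  shows "vec_norm2 (A *\<^sub>v v) \<le> frobenius_norm A * vec_norm2 v"
proof -
  have "(cmod ((A *\<^sub>v v) $ i))\<^sup>2 \<le> (\<Sum>k<c. (cmod (A $$ (i, k)))\<^sup>2) * (vec_norm2 v)\<^sup>2" if "i < r" for i
  proof -
    \<comment> \<open>The entry is a bilinear product; conjugating \<open>v\<close> makes it
      sesquilinear without changing the norm.\<close>
    have "cmod ((A *\<^sub>v v) $ i) = cmod (row A i \<bullet>c conjugate v)"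
      using assms that by simp
    also have "\<dots> \<le> vec_norm2 (row A i) * vec_norm2 (conjugate v)"
      using assms that by (intro Cauchy_Schwarz_vec[of _ c]) auto
    also have "vec_norm2 (conjugate v) = vec_norm2 v"
      unfolding vec_norm2_def by (auto intro!: L2_set_cong)
    finally have "(cmod ((A *\<^sub>v v) $ i))\<^sup>2 \<le> (vec_norm2 (row A i) * vec_norm2 v)\<^sup>2"
      by (intro power_mono) auto
    also have "\<dots> = (\<Sum>k<c. (cmod (A $$ (i, k)))\<^sup>2) * (vec_norm2 v)\<^sup>2"
      using assms that by (simp add: power_mult_distrib vec_norm2_power2)
    finally show ?thesis .
  qed
  then have "(vec_norm2 (A *\<^sub>v v))\<^sup>2 \<le> (\<Sum>i<r. (\<Sum>k<c. (cmod (A $$ (i, k)))\<^sup>2) * (vec_norm2 v)\<^sup>2)"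
    unfolding vec_norm2_power2[of "A *\<^sub>v v"] using A by (auto intro!: sum_mono)
  also have "\<dots> = (frobenius_norm A * vec_norm2 v)\<^sup>2"
    using A by (simp add: power_mult_distrib frobenius_norm_power2 sum_distrib_right)
  finally show ?thesis by (rule power2_le_imp_le) simp
qed

text \<open>A supremum of reals carries information only over a set bounded above; this is the side
  condition of every use of \<open>cSUP_upper\<close>.\<close>

lemma spectral_norm_bdd:
  "bdd_above ((\<lambda>v. vec_norm2 (A *\<^sub>v v)) ` {v \<in> carrier_vec (dim_col A). vec_norm2 v \<le> 1})"
proof (rule bdd_aboveI2)
  fix v assume v: "v \<in> {v \<in> carrier_vec (dim_col A). vec_norm2 v \<le> 1}"
  then have "vec_norm2 (A *\<^sub>v v) \<le> frobenius_norm A * vec_norm2 v"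
    by (intro vec_norm2_mult_frobenius) auto
  also have "\<dots> \<le> frobenius_norm A * 1" using v by (intro mult_left_mono) auto
  finally show "vec_norm2 (A *\<^sub>v v) \<le> frobenius_norm A" by simp
qed

lemma spectral_norm_nonneg [simp]: "0 \<le> spectral_norm A"
proof -
  have "0 \<le> vec_norm2 (A *\<^sub>v 0\<^sub>v (dim_col A))" by simp
  also have "\<dots> \<le> spectral_norm A"
    unfolding spectral_norm_def by (rule cSUP_upper[OF _ spectral_norm_bdd]) simp
  finally show ?thesis .
qed

lemma vec_norm2_mult_spectral:
  assumes A: "A \<in> carrier_mat r c" and v: "v \<in> carrier_vec c"
  shows "vec_norm2 (A *\<^sub>v v) \<le> spectral_norm A * vec_norm2 v"
proof (cases "vec_norm2 v = 0")
  case True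
  then have "v = 0\<^sub>v c" using v by (simp add: vec_norm2_eq_0)
  moreover have "A *\<^sub>v 0\<^sub>v c = 0\<^sub>v r" using A by (intro eq_vecI) auto
  ultimately show ?thesis by simp
next
  case False
  define s where "s = vec_norm2 v"
  have s: "s > 0" using False unfolding s_def by (simp add: less_le)
  define w where "w = of_real (1 / s) \<cdot>\<^sub>v v"
  have w: "w \<in> carrier_vec c" "vec_norm2 w = 1" "v = of_real s \<cdot>\<^sub>v w"
    using v s by (auto simp: w_def vec_norm2_smult s_def[symmetric] smult_smult_assoc norm_divide)
  have "vec_norm2 (A *\<^sub>v w) \<le> spectral_norm A"
    unfolding spectral_norm_def using A w by (intro cSUP_upper[OF _ spectral_norm_bdd]) auto
  then have "s * vec_norm2 (A *\<^sub>v w) \<le> s * spectral_norm A"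
    using s by (intro mult_left_mono) auto
  moreover have "vec_norm2 (A *\<^sub>v v) = s * vec_norm2 (A *\<^sub>v w)"
    unfolding w(3) using A w s by (subst mult_mat_vec[OF A]) (auto simp: vec_norm2_smult)
  ultimately show ?thesis by (simp add: s_def mult.commute)
qed

text \<open>The converse of the previous estimate: it reduces each later bound on a spectral norm to
  an inequality between vector norms.\<close>

lemma spectral_norm_least:
  assumes A: "A \<in> carrier_mat r c" and b: "0 \<le> b"
    and le: "\<And>v. v \<in> carrier_vec c \<Longrightarrow> vec_norm2 (A *\<^sub>v v) \<le> b * vec_norm2 v"
  shows "spectral_norm A \<le> b"
  unfolding spectral_norm_def
proof (rule cSUP_least)
  show "{v \<in> carrier_vec (dim_col A). vec_norm2 v \<le> 1} \<noteq> {}"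
    by (auto intro!: exI[of _ "0\<^sub>v (dim_col A)"])
  fix v assume v: "v \<in> {v \<in> carrier_vec (dim_col A). vec_norm2 v \<le> 1}"
  then have "vec_norm2 (A *\<^sub>v v) \<le> b * vec_norm2 v" using A by (intro le) auto
  also have "\<dots> \<le> b * 1" using v b by (intro mult_left_mono) auto
  finally show "vec_norm2 (A *\<^sub>v v) \<le> b" by simp
qed

lemma spectral_norm_mult:
  assumes A: "A \<in> carrier_mat r k" and B: "B \<in> carrier_mat k c"
  shows "spectral_norm (A * B) \<le> spectral_norm A * spectral_norm B"
proof (rule spectral_norm_least)
  fix v :: "complex vec" assume v: "v \<in> carrier_vec c"
  have "vec_norm2 (A * B *\<^sub>v v) = vec_norm2 (A *\<^sub>v (B *\<^sub>v v))" using assms v by simp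
  also have "\<dots> \<le> spectral_norm A * vec_norm2 (B *\<^sub>v v)"
    using assms v by (intro vec_norm2_mult_spectral) auto
  also have "\<dots> \<le> spectral_norm A * (spectral_norm B * vec_norm2 v)"
    using assms v by (intro mult_left_mono vec_norm2_mult_spectral) auto
  finally show "vec_norm2 (A * B *\<^sub>v v) \<le> spectral_norm A * spectral_norm B * vec_norm2 v"
    by simp
qed (use assms in auto)

lemma spectral_norm_triangle:
  assumes A: "A \<in> carrier_mat r c" and B: "B \<in> carrier_mat r c"
  shows "spectral_norm (A + B) \<le> spectral_norm A + spectral_norm B"
proof (rule spectral_norm_least)
  fix v :: "complex vec" assume v: "v \<in> carrier_vec c"
  have "vec_norm2 ((A + B) *\<^sub>v v) \<le> vec_norm2 (A *\<^sub>v v) + vec_norm2 (B *\<^sub>v v)"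
    using assms v by (subst add_mult_distrib_mat_vec[OF A B v])
      (intro vec_norm2_triangle[of _ r], auto)
  also have "\<dots> \<le> spectral_norm A * vec_norm2 v + spectral_norm B * vec_norm2 v"
    using assms v by (intro add_mono vec_norm2_mult_spectral) auto
  finally show "vec_norm2 ((A + B) *\<^sub>v v) \<le> (spectral_norm A + spectral_norm B) * vec_norm2 v"
    by (simp add: algebra_simps)
qed (use assms in auto)

lemma spectral_norm_uminus_le:
  assumes A: "A \<in> carrier_mat r c"
  shows "spectral_norm (- A) \<le> spectral_norm A"
proof (rule spectral_norm_least)
  fix v :: "complex vec" assume v: "v \<in> carrier_vec c"
  have "- A *\<^sub>v v = - 1 \<cdot>\<^sub>v (A *\<^sub>v v)" using A v by (intro eq_vecI) auto
  then show "vec_norm2 (- A *\<^sub>v v) \<le> spectral_norm A * vec_norm2 v"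
    using vec_norm2_mult_spectral[OF A v] by (simp add: vec_norm2_smult)
qed (use A in auto)

text \<open>With w = A^H v the square of the norm of w is the product of A w with v, hence at most
  ||A|| ||w|| ||v||; one factor ||w|| cancels.\<close>

lemma spectral_norm_adjoint_le:
  assumes A: "A \<in> carrier_mat r c"
  shows "spectral_norm (mat_adjoint A) \<le> spectral_norm A"
proof (rule spectral_norm_least)
  fix v :: "complex vec" assume v: "v \<in> carrier_vec r"
  define w where "w = mat_adjoint A *\<^sub>v v"
  have w: "w \<in> carrier_vec c"
    unfolding w_def by (rule mult_mat_vec_carrier[OF mat_adjoint_carrier[OF A] v])
  have "(vec_norm2 w)\<^sup>2 = cmod (w \<bullet>c w)" by (simp add: cscalar_prod_self norm_power)
  also have "w \<bullet>c w = (A *\<^sub>v w) \<bullet>c v"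
    unfolding cscalar_prod_adjoint[OF A w v] by (simp add: w_def)
  also have "cmod \<dots> \<le> vec_norm2 (A *\<^sub>v w) * vec_norm2 v"
    using A v w by (intro Cauchy_Schwarz_vec[of _ r] mult_mat_vec_carrier) auto
  also have "\<dots> \<le> (spectral_norm A * vec_norm2 w) * vec_norm2 v"
    by (intro mult_right_mono vec_norm2_mult_spectral[OF A w]) auto
  finally have "vec_norm2 w * vec_norm2 w \<le> vec_norm2 w * (spectral_norm A * vec_norm2 v)"
    by (simp add: power2_eq_square mult_ac)
  then show "vec_norm2 w \<le> spectral_norm A * vec_norm2 v"
    by (cases "vec_norm2 w = 0") (auto simp: less_le)
qed (use A in auto)

lemma frobenius_norm_mult_left:
  assumes A: "A \<in> carrier_mat r k" and B: "B \<in> carrier_mat k c"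
  shows "frobenius_norm (A * B) \<le> spectral_norm A * frobenius_norm B"
proof -
  have "(vec_norm2 (col (A * B) i))\<^sup>2 \<le> (spectral_norm A)\<^sup>2 * (vec_norm2 (col B i))\<^sup>2" if "i < c" for i
  proof -
    have "col (A * B) i = A *\<^sub>v col B i" using assms that by (intro eq_vecI) auto
    then have "vec_norm2 (col (A * B) i) \<le> spectral_norm A * vec_norm2 (col B i)"
      using vec_norm2_mult_spectral[OF A, of "col B i"] B that by auto
    then show ?thesis unfolding power_mult_distrib[symmetric] by (intro power_mono) auto
  qed
  then have "(frobenius_norm (A * B))\<^sup>2 \<le> (spectral_norm A * frobenius_norm B)\<^sup>2"
    unfolding power_mult_distrib frobenius_norm_cols sum_distrib_left
    using assms by (auto intro!: sum_mono)
  then show ?thesis by (rule power2_le_imp_le) simp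
qed

text \<open>Taking adjoints exchanges the factors, preserves the Frobenius norm and does not
  increase the spectral norm.\<close>

lemma frobenius_norm_mult_right:
  assumes A: "A \<in> carrier_mat r k" and B: "B \<in> carrier_mat k c"
  shows "frobenius_norm (A * B) \<le> frobenius_norm A * spectral_norm B"
proof -
  have "frobenius_norm (A * B) = frobenius_norm (mat_adjoint B * mat_adjoint A)"
    using mat_adjoint_mult[OF A B] frobenius_norm_adjoint[of "A * B"] by simp
  also have "\<dots> \<le> spectral_norm (mat_adjoint B) * frobenius_norm (mat_adjoint A)"
    using assms by (intro frobenius_norm_mult_left) auto
  also have "\<dots> \<le> spectral_norm B * frobenius_norm (mat_adjoint A)"
    using spectral_norm_adjoint_le[OF B] by (intro mult_right_mono) auto
  finally show ?thesis by (simp add: mult.commute)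
qed

section \<open>Norms of block matrices\<close>

lemma frobenius_norm_four_block:
  assumes "A \<in> carrier_mat r1 c1" "B \<in> carrier_mat r1 c2"
    "C \<in> carrier_mat r2 c1" "D \<in> carrier_mat r2 c2"
  shows "(frobenius_norm (four_block_mat A B C D))\<^sup>2 =
    (frobenius_norm A)\<^sup>2 + (frobenius_norm B)\<^sup>2 + (frobenius_norm C)\<^sup>2 + (frobenius_norm D)\<^sup>2"
  using assms unfolding frobenius_norm_power2
  by (simp add: sum_lessThan_add sum.distrib)

text \<open>The two halves of a vector are mapped separately, so the squares of their norms add up
  under the common bound \<open>b\<close>.\<close>

lemma spectral_norm_diag_le:
  assumes A: "A \<in> carrier_mat k k" and D: "D \<in> carrier_mat k k"
    and b: "spectral_norm A \<le> b" "spectral_norm D \<le> b"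
  shows "spectral_norm (four_block_mat A (0\<^sub>m k k) (0\<^sub>m k k) D) \<le> b"
proof (rule spectral_norm_least)
  show b0: "0 \<le> b" using b(1) spectral_norm_nonneg[of A] by linarith
  fix v :: "complex vec" assume v: "v \<in> carrier_vec (k + k)"
  define v1 v2 where "v1 = vec_first v k" "v2 = vec_last v k"
  have vv: "v = v1 @\<^sub>v v2" "v1 \<in> carrier_vec k" "v2 \<in> carrier_vec k"
    using v by (auto simp: v1_v2_def)
  have *: "vec_norm2 (A' *\<^sub>v w) \<le> b * vec_norm2 w"
    if "A' \<in> carrier_mat k k" "spectral_norm A' \<le> b" "w \<in> carrier_vec k" for A' w
    using vec_norm2_mult_spectral[OF that(1,3)] mult_right_mono[OF that(2), of "vec_norm2 w"] by simp
  have "four_block_mat A (0\<^sub>m k k) (0\<^sub>m k k) D *\<^sub>v v = (A *\<^sub>v v1) @\<^sub>v (D *\<^sub>v v2)"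
    unfolding vv(1) using A D vv(2,3) by (subst four_block_mat_mult_vec[of _ k k _ k _ k]) auto
  then have "(vec_norm2 (four_block_mat A (0\<^sub>m k k) (0\<^sub>m k k) D *\<^sub>v v))\<^sup>2
    \<le> (b * vec_norm2 v1)\<^sup>2 + (b * vec_norm2 v2)\<^sup>2"
    using A D b vv by (auto simp: vec_norm2_append_power2 intro!: add_mono power_mono *)
  also have "\<dots> = (b * vec_norm2 v)\<^sup>2"
    by (simp add: vv(1) vec_norm2_append_power2 power_mult_distrib algebra_simps)
  finally show "vec_norm2 (four_block_mat A (0\<^sub>m k k) (0\<^sub>m k k) D *\<^sub>v v) \<le> b * vec_norm2 v"
    by (rule power2_le_imp_le) (use b0 in simp)
qed (use A D in auto)

lemma spectral_norm_lower_le: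
  assumes Z: "Z \<in> carrier_mat k k"
  shows "spectral_norm (four_block_mat (0\<^sub>m k k) (0\<^sub>m k k) Z (0\<^sub>m k k)) \<le> spectral_norm Z"
proof (rule spectral_norm_least)
  fix v :: "complex vec" assume v: "v \<in> carrier_vec (k + k)"
  define v1 v2 where "v1 = vec_first v k" "v2 = vec_last v k"
  have vv: "v = v1 @\<^sub>v v2" "v1 \<in> carrier_vec k" "v2 \<in> carrier_vec k"
    using v by (auto simp: v1_v2_def)
  have "four_block_mat (0\<^sub>m k k) (0\<^sub>m k k) Z (0\<^sub>m k k) *\<^sub>v v = 0\<^sub>v k @\<^sub>v (Z *\<^sub>v v1)"
    unfolding vv(1) using Z vv(2,3) by (subst four_block_mat_mult_vec[of _ k k _ k _ k]) auto
  then have "(vec_norm2 (four_block_mat (0\<^sub>m k k) (0\<^sub>m k k) Z (0\<^sub>m k k) *\<^sub>v v))\<^sup>2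
    \<le> (spectral_norm Z * vec_norm2 v1)\<^sup>2"
    using vec_norm2_mult_spectral[OF Z vv(2)]
    by (auto simp: vec_norm2_append_power2 intro!: power_mono)
  also have "\<dots> \<le> (spectral_norm Z * vec_norm2 v)\<^sup>2"
    by (simp add: vv(1) vec_norm2_append_power2 power_mult_distrib algebra_simps)
  finally show "vec_norm2 (four_block_mat (0\<^sub>m k k) (0\<^sub>m k k) Z (0\<^sub>m k k) *\<^sub>v v)
    \<le> spectral_norm Z * vec_norm2 v"
    by (rule power2_le_imp_le) simp
qed (use Z in auto)

section \<open>The entrywise recursion\<close>

text \<open>By Pascal's rule the binomial terms alone satisfy the homogeneous recursion with equality;
  the subtracted constants \<open>3\<close> are what absorbs the inhomogeneous terms.\<close>

lemma binomial_recursion_bound: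
  fixes g :: "nat \<Rightarrow> nat \<Rightarrow> real" and x y p q :: real
  assumes x: "3 \<le> x" and y: "3 \<le> y" and p: "0 \<le> p" and q: "0 \<le> q"
    and g0: "\<And>b. g 0 b = 0" "\<And>a. g a 0 = 0"
    and rec: "\<And>a b. a < m \<Longrightarrow> b < k \<Longrightarrow> g (Suc a) (Suc b) \<le> x * g a (Suc b) + y * g (Suc a) b
       + x * (1 + of_bool (0 < a)) * p + y * (1 + of_bool (0 < b)) * q"
    and a: "a < m" and b: "b < k"
  shows "g (Suc a) (Suc b) \<le>
      p * (2 * x ^ Suc a * y ^ b * real (Suc (a + b) choose Suc a) - 3)
    + q * (2 * x ^ a * y ^ Suc b * real (Suc (a + b) choose Suc b) - 3)"
proof -
  \<comment> \<open>The factor 2 is fixed by the corner \<open>a = b = 0\<close>: the claim there is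
    x p + y q \<le> (2 x - 3) p + (2 y - 3) q, which follows from 3 \<le> x and 3 \<le> y.\<close>
  define P where "P a b = 2 * x ^ Suc a * y ^ b * real (Suc (a + b) choose Suc a)" for a b
  define Q where "Q a b = 2 * x ^ a * y ^ Suc b * real (Suc (a + b) choose Suc b)" for a b
  have P_rec: "P (Suc a) (Suc b) = x * P a (Suc b) + y * P (Suc a) b" for a b
    unfolding P_def by (simp add: algebra_simps)
  have Q_rec: "Q (Suc a) (Suc b) = x * Q a (Suc b) + y * Q (Suc a) b" for a b
    unfolding Q_def by (simp add: algebra_simps)
  have P_0: "P a 0 = 2 * x ^ Suc a" for a by (simp add: P_def)
  have Q_0: "Q 0 b = 2 * y ^ Suc b" for b by (simp add: Q_def)
  \<comment> \<open>On the edge \<open>a = 0\<close> the binomial coefficient is b + 1. Its growth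
    by one leaves 2 x y^(b+1) above the homogeneous step, and this pays for the source x p.\<close>
  have P_0_Suc: "P 0 (Suc b) \<ge> y * P 0 b + x" for b
  proof -
    have "1 * x \<le> (2 * y ^ Suc b) * x"
      using x y one_le_power[of y "Suc b"] by (intro mult_right_mono) linarith+
    then show ?thesis unfolding P_def by (simp add: algebra_simps)
  qed
  have Q_Suc_0: "Q (Suc a) 0 \<ge> x * Q a 0 + y" for a
  proof -
    have "1 * y \<le> (2 * x ^ Suc a) * y"
      using x y one_le_power[of x "Suc a"] by (intro mult_right_mono) linarith+
    then show ?thesis unfolding Q_def by (simp add: algebra_simps)
  qed
  have px: "p * 3 \<le> p * x" and py: "p * 3 \<le> p * y" and qx: "q * 3 \<le> q * x" and qy: "q * 3 \<le> q * y"
    using x y p q by (auto intro!: mult_left_mono)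
  have "g (Suc a) (Suc b) \<le> p * (P a b - 3) + q * (Q a b - 3)"
    using a b
  \<comment> \<open>The recursion refers to both predecessors (a - 1, b) and (a, b - 1), so the
    induction runs along antidiagonals.\<close>
  proof (induction "a + b" arbitrary: a b rule: less_induct)
    case less
    note rec = rec[OF less.prems]
    have IH1: "x * g (Suc a') (Suc b) \<le> x * (p * (P a' b - 3) + q * (Q a' b - 3))" if "a = Suc a'" for a'
      using less.hyps[of a' b] less.prems that x by (intro mult_left_mono) auto
    have IH2: "y * g (Suc a) (Suc b') \<le> y * (p * (P a b' - 3) + q * (Q a b' - 3))" if "b = Suc b'" for b'
      using less.hyps[of a b'] less.prems that y by (intro mult_left_mono) auto
    show ?case
    proof (cases a; cases b)
      assume [simp]: "a = 0" "b = 0"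
      show ?thesis using rec g0 p q px qy by (simp add: P_0 Q_0 algebra_simps)
    next
      fix b' assume b': "a = 0" "b = Suc b'"
      show ?thesis
        using rec IH2[OF b'(2)] mult_left_mono[OF P_0_Suc[of b'] p] p q px py qy unfolding b'
        by (simp add: Q_0 g0 algebra_simps)
    next
      fix a' assume a': "a = Suc a'" "b = 0"
      show ?thesis
        using rec IH1[OF a'(1)] mult_left_mono[OF Q_Suc_0[of a'] q] p q px qx qy unfolding a'
        by (simp add: P_0 g0 algebra_simps)
    next
      \<comment> \<open>Here the sources are doubled, but the constants in the two hypotheses
        contribute -3 x - 3 y, and -3 x - 3 y + 2 x \<le> -3, likewise with 2 y.\<close>
      fix a' b' assume ab: "a = Suc a'" "b = Suc b'"
      show ?thesis
        using rec IH1[OF ab(1)] IH2[OF ab(2)] p q px py qx qy unfolding ab P_rec Q_rec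
        by (simp add: algebra_simps)
    qed
  qed
  then show ?thesis by (simp add: P_def Q_def)
qed

lemma L2_set_double_power2:
  fixes f :: "nat \<Rightarrow> nat \<Rightarrow> complex"
  shows "(L2_set (\<lambda>(i, j). cmod (f i j)) (I \<times> J))\<^sup>2 = (\<Sum>i\<in>I. \<Sum>j\<in>J. (cmod (f i j))\<^sup>2)"
  unfolding L2_set_def by (simp add: sum_nonneg sum.cartesian_product case_prod_unfold)

text \<open>The norms of the lower right corners of \<open>y\<close> satisfy the recursion above; the hypothesis
  involves only the moduli of the eigenvalues and a lower bound for their distance, so it also
  covers the off-diagonal couplings of conjugate eigenvalues.\<close>

lemma sylvester_block_bound:
  fixes y p q :: "nat \<Rightarrow> nat \<Rightarrow> complex" and \<mu> \<nu> :: complex and c d \<delta> :: real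
  assumes m: "0 < m" and k: "0 < k" and \<delta>: "0 < \<delta>" "\<delta> \<le> cmod (\<nu> - \<mu>)"
    and c: "cmod \<mu> = c" "3 * \<delta> \<le> c" and d: "cmod \<nu> = d" "3 * \<delta> \<le> d"
    and zero: "\<And>i j. m \<le> i \<or> k \<le> j \<Longrightarrow> y i j = 0 \<and> p i j = 0 \<and> q i j = 0"
    and eq: "\<And>i j. i < m \<Longrightarrow> j < k \<Longrightarrow>
      (\<nu> - \<mu>) * y i j = of_real c * y (Suc i) j - of_real d * y i (Suc j)
        + \<mu> * p i j + of_real c * p (Suc i) j - \<nu> * q i j - of_real d * q i (Suc j)"
  shows "((\<delta> / c) ^ m * (\<delta> / d) ^ k)\<^sup>2 * (\<Sum>i<m. \<Sum>j<k. (cmod (y i j))\<^sup>2)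
    \<le> 4 * ((\<delta> / c)\<^sup>2 + (\<delta> / d)\<^sup>2)
       * ((real ((k + m - 1) choose m))\<^sup>2 * (\<Sum>i<m. \<Sum>j<k. (cmod (p i j))\<^sup>2)
         + (real ((k + m - 1) choose k))\<^sup>2 * (\<Sum>i<m. \<Sum>j<k. (cmod (q i j))\<^sup>2))"
proof -
  \<comment> \<open>The last \<open>a\<close> rows and last \<open>b\<close> columns. An entry is
    coupled only to its neighbours below and to the right, so estimates on such corners involve only
    smaller corners.\<close>
  define S where "S a b = {m - a..<m} \<times> {k - b..<k}" for a b
  define N where "N f a b = L2_set (\<lambda>(i, j). cmod (f i j)) (S a b)"
    for f :: "nat \<Rightarrow> nat \<Rightarrow> complex" and a b
  have cd: "0 < c" "0 < d" using \<delta> c d by linarith+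
  have N0: "N f 0 b = 0" "N f a 0 = 0" for f a b by (auto simp: N_def S_def)
  have N_nonneg: "0 \<le> N f a b" for f a b by (simp add: N_def)
  have N_mono: "N f a b \<le> N f m k" for f a b
    unfolding N_def S_def L2_set_def
    by (intro real_sqrt_le_mono sum_mono2) auto
  \<comment> \<open>A window of a + 1 rows moved down by one ends in row \<open>m\<close>, where
    \<open>f\<close> vanishes; what is left is the corner with \<open>a\<close> rows.\<close>
  have shift1: "N (\<lambda>i. f (Suc i)) (Suc a) b = N f a b"
    if "\<And>j. f m j = 0" "a < m" for f a b
  proof -
    have "(N (\<lambda>i. f (Suc i)) (Suc a) b)\<^sup>2
        = (\<Sum>i=Suc (m - Suc a)..<Suc m. \<Sum>j=k-b..<k. (cmod (f i j))\<^sup>2)"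
      unfolding N_def S_def L2_set_double_power2
      by (subst sum.shift_bounds_Suc_ivl) simp
    also have "\<dots> = (N f a b)\<^sup>2"
      using that by (simp add: N_def S_def L2_set_double_power2 Suc_diff_Suc)
    finally show ?thesis by (simp add: N_def)
  qed
  have shift2: "N (\<lambda>i j. f i (Suc j)) a (Suc b) = N f a b"
    if "\<And>i. f i k = 0" "b < k" for f a b
  proof -
    have "(N (\<lambda>i j. f i (Suc j)) a (Suc b))\<^sup>2
        = (\<Sum>i=m-a..<m. \<Sum>j=Suc (k - Suc b)..<Suc k. (cmod (f i j))\<^sup>2)"
      unfolding N_def S_def L2_set_double_power2
      by (subst sum.shift_bounds_Suc_ivl) simp
    also have "\<dots> = (N f a b)\<^sup>2"
      proof -
      have "\<not> k < k - b" by simp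
      then show ?thesis
        using that by (simp add: N_def S_def L2_set_double_power2 Suc_diff_Suc)
    qed
    finally show ?thesis by (simp add: N_def)
  qed
  have scale: "L2_set (\<lambda>z. r * f z) T = r * L2_set f T" if "0 \<le> r"
    for r :: real and f :: "nat \<times> nat \<Rightarrow> real" and T
    using that by (simp add: L2_set_right_distrib)
  have rec: "\<delta> * N y (Suc a) (Suc b) \<le> c * N y a (Suc b) + d * N y (Suc a) b
      + c * (1 + of_bool (0 < a)) * N p m k + d * (1 + of_bool (0 < b)) * N q m k"
    if a: "a < m" and b: "b < k" for a b
  proof -
    let ?T = "S (Suc a) (Suc b)"
    have "\<delta> * cmod (y i j) \<le> c * cmod (y (Suc i) j) + d * cmod (y i (Suc j))
        + (c * cmod (p i j) + c * cmod (p (Suc i) j)) + (d * cmod (q i j) + d * cmod (q i (Suc j)))"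
      if "(i, j) \<in> ?T" for i j
    proof -
      have ij: "i < m" "j < k" using that by (auto simp: S_def)
      have "\<delta> * cmod (y i j) \<le> cmod ((\<nu> - \<mu>) * y i j)"
        unfolding norm_mult by (intro mult_right_mono \<delta>) auto
      also have "\<dots> \<le> cmod (of_real c * y (Suc i) j) + cmod (of_real d * y i (Suc j))
        + (cmod (\<mu> * p i j) + cmod (of_real c * p (Suc i) j))
        + (cmod (\<nu> * q i j) + cmod (of_real d * q i (Suc j)))"
        unfolding eq[OF ij]
        by (smt (verit) norm_triangle_ineq norm_triangle_ineq4)
      finally show ?thesis using c d cd by (simp add: norm_mult)
    qed
    then have "L2_set (\<lambda>z. \<delta> * (case z of (i, j) \<Rightarrow> cmod (y i j))) ?T
      \<le> L2_set (\<lambda>z. c * (case z of (i, j) \<Rightarrow> cmod (y (Suc i) j))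
          + d * (case z of (i, j) \<Rightarrow> cmod (y i (Suc j)))
          + (c * (case z of (i, j) \<Rightarrow> cmod (p i j)) + c * (case z of (i, j) \<Rightarrow> cmod (p (Suc i) j)))
          + (d * (case z of (i, j) \<Rightarrow> cmod (q i j)) + d * (case z of (i, j) \<Rightarrow> cmod (q i (Suc j))))) ?T"
      using \<delta> by (intro L2_set_mono) (auto simp del: of_real_mult)
    also have "\<dots> \<le> L2_set (\<lambda>z. c * (case z of (i, j) \<Rightarrow> cmod (y (Suc i) j))) ?T
          + L2_set (\<lambda>z. d * (case z of (i, j) \<Rightarrow> cmod (y i (Suc j)))) ?T
          + (L2_set (\<lambda>z. c * (case z of (i, j) \<Rightarrow> cmod (p i j))) ?T
            + L2_set (\<lambda>z. c * (case z of (i, j) \<Rightarrow> cmod (p (Suc i) j))) ?T)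
          + (L2_set (\<lambda>z. d * (case z of (i, j) \<Rightarrow> cmod (q i j))) ?T
            + L2_set (\<lambda>z. d * (case z of (i, j) \<Rightarrow> cmod (q i (Suc j)))) ?T)"
      by (intro order.trans[OF L2_set_triangle_ineq] add_mono order.refl)
    finally have "\<delta> * N y (Suc a) (Suc b) \<le> c * N y a (Suc b) + d * N y (Suc a) b
        + (c * N p (Suc a) (Suc b) + c * N p a (Suc b)) + (d * N q (Suc a) (Suc b) + d * N q (Suc a) b)"
      using \<delta>(1) cd a b zero by (simp add: scale shift1 shift2 N_def[symmetric])
    moreover have "c * N p (Suc a) (Suc b) \<le> c * N p m k" "d * N q (Suc a) (Suc b) \<le> d * N q m k"
      using cd by (auto intro!: mult_left_mono N_mono)
    \<comment> \<open>For \<open>a = 0\<close> the shifted corner is empty. Keeping track of this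
      through \<open>of_bool\<close> is what makes the start of the recursion fit the constant
      3.\<close>
    moreover have "c * N p a (Suc b) \<le> c * (of_bool (0 < a) * N p m k)"
      using cd N_mono[of p a "Suc b"] by (intro mult_left_mono) (auto simp: N0)
    moreover have "d * N q (Suc a) b \<le> d * (of_bool (0 < b) * N q m k)"
      using cd N_mono[of q "Suc a" b] by (intro mult_left_mono) (auto simp: N0)
    ultimately show ?thesis by (simp add: algebra_simps)
  qed
  \<comment> \<open>The reciprocals of the relative gaps; \<open>3 * \<delta> \<le> c\<close> and
    \<open>3 * \<delta> \<le> d\<close> become 3 \<le> x and 3 \<le> z.\<close>
  define x z where "x = c / \<delta>" and "z = d / \<delta>"
  have xz: "3 \<le> x" "3 \<le> z" using c d \<delta> by (auto simp: x_def z_def le_divide_eq)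
  have "N y (Suc a) (Suc b) \<le> x * N y a (Suc b) + z * N y (Suc a) b
      + x * (1 + of_bool (0 < a)) * N p m k + z * (1 + of_bool (0 < b)) * N q m k"
    if "a < m" "b < k" for a b
    using divide_right_mono[OF rec[OF that], of \<delta>] \<delta>(1)
    by (simp add: x_def z_def add_divide_distrib)
  note bound = binomial_recursion_bound[of x z "N p m k" "N q m k" "N y" m k, OF xz N_nonneg N_nonneg N0 this]
  \<comment> \<open>The recursion numbers nonempty corners from 0, so the full block has indices m -
    1 and k - 1, and their sum plus one is the upper index k + m - 1 of the binomials.\<close>
  obtain m' k' where mk: "m = Suc m'" "k = Suc k'" using m k by (auto simp: gr0_conv_Suc)
  define C1 C2 where "C1 = real ((k + m - 1) choose m)" and "C2 = real ((k + m - 1) choose k)"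
  have "N y m k \<le> N p m k * (2 * x ^ m * z ^ k' * C1 - 3) + N q m k * (2 * x ^ m' * z ^ k * C2 - 3)"
    using bound[of m' k'] by (simp add: mk C1_def C2_def add.commute)
  also have "\<dots> \<le> N p m k * (2 * x ^ m * z ^ k' * C1) + N q m k * (2 * x ^ m' * z ^ k * C2)"
    by (intro add_mono mult_left_mono N_nonneg) auto
  finally have "(1 / x) ^ m * (1 / z) ^ k * N y m k
      \<le> (1 / x) ^ m * (1 / z) ^ k * (N p m k * (2 * x ^ m * z ^ k' * C1) + N q m k * (2 * x ^ m' * z ^ k * C2))"
    using xz by (intro mult_left_mono) auto
  \<comment> \<open>All powers cancel except one: the term in \<open>p\<close> has one power of z
    too few and the term in \<open>q\<close> one power of x too few.\<close>
  also have "\<dots> = 2 * ((1 / z) * (C1 * N p m k) + (1 / x) * (C2 * N q m k))"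
    using xz by (simp add: mk field_simps)
  finally have "((1 / x) ^ m * (1 / z) ^ k * N y m k)\<^sup>2
      \<le> (2 * ((1 / z) * (C1 * N p m k) + (1 / x) * (C2 * N q m k)))\<^sup>2"
    using xz N_nonneg by (intro power_mono) auto
  also have "\<dots> \<le> 4 * ((1 / x)\<^sup>2 + (1 / z)\<^sup>2) * ((C1 * N p m k)\<^sup>2 + (C2 * N q m k)\<^sup>2)"
  proof -
    \<comment> \<open>Cauchy-Schwarz in the plane, with the defect (r u - t s)^2 of the Lagrange
      identity.\<close>
    have "(2 * (r * s + t * u))\<^sup>2 \<le> 4 * (t\<^sup>2 + r\<^sup>2) * (s\<^sup>2 + u\<^sup>2)" for r s t u :: real
      using zero_le_power2[of "r * u - t * s"] by (simp add: power2_eq_square algebra_simps)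
    then show ?thesis .
  qed
  finally show ?thesis
    by (simp add: x_def z_def C1_def C2_def power_mult_distrib N_def S_def L2_set_double_power2
        lessThan_atLeast0)
qed

section \<open>Canonical blocks\<close>

lemma nth_concat_take:
  "j < length xss \<Longrightarrow> k < length (xss ! j) \<Longrightarrow>
   concat xss ! (sum_list (map length (take j xss)) + k) = xss ! j ! k"
proof (induction xss arbitrary: j)
  case (Cons xs xss)
  then show ?case by (cases j) (auto simp: nth_append)
qed simp

lemma dim_diag_block_mat_square:
  assumes "\<forall>A \<in> set As. square_mat A"
  shows "dim_row (diag_block_mat As) = sum_list (map dim_col As)"
    "dim_col (diag_block_mat As) = sum_list (map dim_col As)"
  using assms by (induction As) (auto simp: Let_def)

text \<open>The offset \<open>r\<close> enters through an equation, so that it may be expressed by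
  the block sizes of the canonical form as well as by matrix dimensions.\<close>

lemma diag_block_mat_index:
  assumes "\<forall>A \<in> set As. square_mat A" "j < length As" "k < dim_col (As ! j)"
    "i < dim_row (diag_block_mat As)" "r = sum_list (map dim_col (take j As))"
  shows "diag_block_mat As $$ (i, r + k) =
    (if r \<le> i \<and> i < r + dim_col (As ! j) then As ! j $$ (i - r, k) else 0)"
  using assms
proof (induction As arbitrary: j i r)
  case (Cons A As)
  have sq: "dim_row A = dim_col A" and sqs: "\<forall>A \<in> set As. square_mat A" using Cons.prems by auto
  note dims = dim_diag_block_mat_square[OF sqs]
  show ?case
  proof (cases j)
    case 0
    then show ?thesis using Cons.prems sq by (auto simp: Let_def)
  next
    case (Suc j')
    define r' where "r' = sum_list (map dim_col (take j' As))"
    have r: "r = dim_col A + r'" using Cons.prems Suc by (simp add: r'_def)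
    have lt: "r' + k < dim_col (diag_block_mat As)"
    proof -
      have "sum_list (map dim_col (take (Suc j') As)) \<le> sum_list (map dim_col As)"
        by (subst append_take_drop_id[of "Suc j'" As, symmetric])
          (simp only: map_append sum_list_append le_add1)
      then show ?thesis
        using Cons.prems Suc by (simp add: dims r'_def take_Suc_conv_app_nth)
    qed
    show ?thesis
    proof (cases "i < dim_col A")
      case True
      then show ?thesis using Cons.prems(1-4) Suc sq lt by (auto simp: Let_def r)
    next
      case False
      then have "diag_block_mat (A # As) $$ (i, r + k) = diag_block_mat As $$ (i - dim_col A, r' + k)"
        using Cons.prems(4) sq lt by (auto simp: Let_def r)
      also have "\<dots> = (if r' \<le> i - dim_col A \<and> i - dim_col A < r' + dim_col (As ! j')
          then As ! j' $$ (i - dim_col A - r', k) else 0)"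
        using Cons.prems Suc False sq by (intro Cons.IH) (auto simp: r'_def Let_def)
      also have "\<dots> = (if r \<le> i \<and> i < r + dim_col ((A # As) ! j)
          then (A # As) ! j $$ (i - r, k) else 0)"
        using False Suc by (auto simp: r)
      finally show ?thesis .
    qed
  qed
qed simp

text \<open>Columns r, ..., r + s - 1 of the identity. Multiplication from the right extracts these
  columns, which turns the partition of \<open>X\<close> into matrix algebra.\<close>

definition selection_mat :: "nat \<Rightarrow> nat \<Rightarrow> nat \<Rightarrow> complex mat" where
  "selection_mat N r s = mat N s (\<lambda>(i, k). if i = r + k then 1 else 0)"

lemma selection_mat_carrier [simp]: "selection_mat N r s \<in> carrier_mat N s"
  by (simp add: selection_mat_def)

lemma mult_selection_mat:
  assumes "A \<in> carrier_mat t N" "r + s \<le> N"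
  shows "A * selection_mat N r s = mat t s (\<lambda>(i, k). A $$ (i, r + k))"
proof (rule eq_matI)
  fix i k assume "i < dim_row (mat t s (\<lambda>(i, k). A $$ (i, r + k)))"
    "k < dim_col (mat t s (\<lambda>(i, k). A $$ (i, r + k)))"
  then have ik: "i < t" "k < s" by auto
  then have "(A * selection_mat N r s) $$ (i, k)
      = (\<Sum>l<N. A $$ (i, l) * (if l = r + k then 1 else 0))"
    using assms by (simp add: selection_mat_def scalar_prod_def lessThan_atLeast0)
  also have "\<dots> = (\<Sum>l<N. if l = r + k then A $$ (i, l) else 0)"
    by (rule sum.cong) auto
  also have "\<dots> = A $$ (i, r + k)" using ik assms(2) by simp
  finally show "(A * selection_mat N r s) $$ (i, k) = mat t s (\<lambda>(i, k). A $$ (i, r + k)) $$ (i, k)"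
    using ik by simp
qed (use assms in \<open>auto simp: selection_mat_def\<close>)

lemma selection_mat_mult:
  assumes "A \<in> carrier_mat s t"
  shows "selection_mat N r s * A = mat N t (\<lambda>(i, k). if r \<le> i \<and> i < r + s then A $$ (i - r, k) else 0)"
    (is "_ = ?R")
proof (rule eq_matI)
  fix i k assume "i < dim_row ?R" "k < dim_col ?R"
  then have ik: "i < N" "k < t" by auto
  then have "(selection_mat N r s * A) $$ (i, k)
      = (\<Sum>l<s. (if i = r + l then 1 else 0) * A $$ (l, k))"
    using assms by (simp add: selection_mat_def scalar_prod_def lessThan_atLeast0)
  also have "\<dots> = (\<Sum>l<s. if l = i - r then (if r \<le> i then A $$ (l, k) else 0) else 0)"
    by (rule sum.cong) auto
  also have "\<dots> = ?R $$ (i, k)" using ik by (auto simp: less_diff_conv2)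
  finally show "(selection_mat N r s * A) $$ (i, k) = ?R $$ (i, k)" .
qed (use assms in \<open>auto simp: selection_mat_def\<close>)

lemma adjoint_selection_mat_mult:
  assumes "r + s \<le> N"
  shows "mat_adjoint (selection_mat N r s) * selection_mat N r s = 1\<^sub>m s"
  using assms
  by (subst mult_selection_mat[of _ s]) (auto simp: selection_mat_def intro!: eq_matI)

lemma block_carrier:
  "block_Lambda b \<in> carrier_mat (block_size b) (block_size b)"
  "block_Omega b \<in> carrier_mat (block_size b) (block_size b)"
  by (cases b; auto simp: F_mat_def G_mat_def)+

text \<open>The isometry \<open>E\<close> intertwines each direct sum with its j-th summand. From
  here on blocks are handled through these identities, without column offsets.\<close>

lemma canonical_decomposition_block:
  assumes dec: "canonical_decomposition N A B X Xs bs" and j: "j < length bs"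
  obtains E where "E \<in> carrier_mat N (block_size (bs ! j))"
    "mat_adjoint E * E = 1\<^sub>m (block_size (bs ! j))"
    "Xs ! j = X * E"
    "(mat_adjoint X * A * X) * E = E * block_Lambda (bs ! j)"
    "(mat_adjoint X * B * X) * E = E * block_Omega (bs ! j)"
proof -
  define s where "s = block_size (bs ! j)"
  have len: "length Xs = length bs"
    and Xs: "\<And>i. i < length bs \<Longrightarrow> Xs ! i \<in> carrier_mat N (block_size (bs ! i))"
    and X: "X = hcat N Xs" "X \<in> carrier_mat N N"
    and AD: "mat_adjoint X * A * X = diag_block_mat (map block_Lambda bs)"
    and BD: "mat_adjoint X * B * X = diag_block_mat (map block_Omega bs)"
    using dec unfolding canonical_decomposition_def by auto
  define r where "r = sum_list (map block_size (take j bs))"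
  have szs: "map dim_col Xs = map block_size bs"
    using Xs len by (intro nth_equalityI) auto
  \<comment> \<open>The total of the block sizes is the width of the concatenation, and this is
    \<open>N\<close> because \<open>X\<close> is square.\<close>
  have N: "N = sum_list (map block_size bs)"
  proof -
    have "N = dim_col (hcat N Xs)" using X by auto
    also have "\<dots> = sum_list (map dim_col Xs)" by (simp add: hcat_def length_concat o_def)
    finally show ?thesis by (simp add: szs)
  qed
  have rs: "r + s \<le> N"
  proof -
    have "sum_list (map block_size (take (Suc j) bs)) \<le> sum_list (map block_size bs)"
      by (subst append_take_drop_id[of "Suc j" bs, symmetric])
        (simp only: map_append sum_list_append le_add1)
    then show ?thesis using j by (simp add: N r_def s_def take_Suc_conv_app_nth)
  qed
  define E where "E = selection_mat N r s"
  have diag: "diag_block_mat (map f bs) * E = E * f (bs ! j)"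
    if f: "\<And>b. f b \<in> carrier_mat (block_size b) (block_size b)" for f :: "canonical_block \<Rightarrow> complex mat"
  proof -
    have sq: "\<forall>A \<in> set (map f bs). square_mat A" using carrier_matD[OF f] by simp
    have dc: "dim_col (f b) = block_size b" for b by (rule carrier_matD(2)[OF f])
    have D: "diag_block_mat (map f bs) \<in> carrier_mat N N"
      using dim_diag_block_mat_square[OF sq] by (auto simp: N o_def dc)
    have r': "r = sum_list (map dim_col (take j (map f bs)))"
      by (simp add: r_def take_map o_def dc)
    have "diag_block_mat (map f bs) * E = mat N s (\<lambda>(i, k). diag_block_mat (map f bs) $$ (i, r + k))"
      unfolding E_def by (rule mult_selection_mat[OF D rs])
    also have "\<dots> = mat N s (\<lambda>(i, k). if r \<le> i \<and> i < r + s then f (bs ! j) $$ (i - r, k) else 0)"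
      using diag_block_mat_index[OF sq, of j] j D r' by (intro eq_matI) (auto simp: dc s_def)
    also have "\<dots> = E * f (bs ! j)"
      unfolding E_def by (rule selection_mat_mult[symmetric]) (simp add: s_def f)
    finally show ?thesis .
  qed
  have "Xs ! j = X * E"
  proof -
    have "X $$ (i, r + k) = Xs ! j $$ (i, k)" if "i < N" "k < s" for i k
    proof -
      have "r = sum_list (map dim_col (take j Xs))"
        using szs by (simp add: r_def take_map[symmetric])
      then have r: "r = sum_list (map length (take j (map cols Xs)))"
        by (simp add: take_map o_def)
      have "concat (map cols Xs) ! (r + k) = cols (Xs ! j) ! k"
        unfolding r using that j len Xs[OF j] by (subst nth_concat_take) (auto simp: s_def)
      moreover have "r + k < length (concat (map cols Xs))"
        using rs that szs by (simp add: length_concat o_def N)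
      ultimately show ?thesis
        using that Xs[OF j] by (simp add: X(1) hcat_def mat_of_cols_index s_def)
    qed
    then show ?thesis
      unfolding E_def mult_selection_mat[OF X(2) rs] using Xs[OF j]
      by (intro eq_matI) (auto simp: s_def)
  qed
  moreover have "E \<in> carrier_mat N s" "mat_adjoint E * E = 1\<^sub>m s"
    by (simp_all add: E_def adjoint_selection_mat_mult[OF rs])
  ultimately show ?thesis
    using that[of E] diag[of block_Lambda] diag[of block_Omega] block_carrier
    by (simp add: AD BD s_def)
qed

section \<open>Inverses, and direct sums of bidiagonal matrices\<close>

lemma mat_inv:
  assumes A: "A \<in> carrier_mat k k" and inv: "invertible_mat A"
  shows "mat_inv A \<in> carrier_mat k k" "A * mat_inv A = 1\<^sub>m k" "mat_inv A * A = 1\<^sub>m k"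
proof -
  obtain B where B: "A * B = 1\<^sub>m (dim_row A)" "B * A = 1\<^sub>m (dim_row B)"
    using inv unfolding invertible_mat_def inverts_mat_def by auto
  \<comment> \<open>Invertibility names no dimensions for the inverse; the two product identities
    force them.\<close>
  have "dim_row B = k" using arg_cong[OF B(2), of dim_col] A by simp
  moreover have "dim_col B = k" using arg_cong[OF B(1), of dim_col] A by simp
  ultimately have "A \<in> Units (ring_mat TYPE(complex) k undefined)"
    using A B by (auto simp: Units_def ring_mat_simps)
  then obtain A' where A': "mat_inverse A = Some A'"
    using mat_inverse(1)[OF A, where b = undefined] by (cases "mat_inverse A") auto
  then have "mat_inv A = A'" by (simp add: mat_inv_def)
  then show "mat_inv A \<in> carrier_mat k k" "A * mat_inv A = 1\<^sub>m k" "mat_inv A * A = 1\<^sub>m k"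
    using mat_inverse(2)[OF A A'] by auto
qed

text \<open>The direct sum of \<open>r\<close> lower bidiagonal blocks of order \<open>m\<close>,
  with diagonal entry \<open>\<mu> e\<close> in block \<open>e\<close>; the test
  \<open>i mod m \<noteq> 0\<close> interrupts the subdiagonal between blocks. Real eigenvalues use
  one block, type R4 uses two.\<close>

definition bidiag :: "nat \<Rightarrow> nat \<Rightarrow> (nat \<Rightarrow> complex) \<Rightarrow> complex \<Rightarrow> complex mat" where
  "bidiag r m \<mu> c = mat (r * m) (r * m) (\<lambda>(i, k). if i = k then \<mu> (i div m)
     else if i = Suc k \<and> i mod m \<noteq> 0 then c else 0)"

lemma bidiag_carrier [simp]: "bidiag r m \<mu> c \<in> carrier_mat (r * m) (r * m)"
  by (simp add: bidiag_def)

lemma block_index_less: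
  fixes e r k m :: nat
  assumes "e < r" "k < m"
  shows "e * m + k < r * m"
proof -
  have "e * m + k < Suc e * m" using assms by simp
  also have "\<dots> \<le> r * m" using assms by (intro mult_right_mono) auto
  finally show ?thesis .
qed

text \<open>In the index e * m + k the number \<open>e\<close> names the diagonal block and
  \<open>k\<close> the place inside it. The condition \<open>Suc k < m\<close> expresses that
  nothing leaks into the next block.\<close>

lemma mult_bidiag_index:
  assumes Z: "Z \<in> carrier_mat t (r * m)" and i: "i < t" and k: "k < m" and e: "e < r"
  shows "(Z * bidiag r m \<mu> c) $$ (i, e * m + k) =
    Z $$ (i, e * m + k) * \<mu> e + (if Suc k < m then Z $$ (i, Suc (e * m + k)) * c else 0)"
proof -
  let ?k = "e * m + k"
  have lt: "?k < r * m" by (rule block_index_less[OF e k])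
  have div: "?k div m = e" using k by simp
  have mod: "Suc ?k mod m \<noteq> 0 \<longleftrightarrow> Suc k < m"
    using k mod_mult_self3[of e m "Suc k"] by (cases "Suc k = m") auto
  have "(Z * bidiag r m \<mu> c) $$ (i, ?k) = (\<Sum>l<r * m. Z $$ (i, l) *
      (if l = ?k then \<mu> (l div m) else if l = Suc ?k \<and> l mod m \<noteq> 0 then c else 0))"
    using Z i lt by (simp add: bidiag_def scalar_prod_def lessThan_atLeast0)
  also have "\<dots> = (\<Sum>l<r * m. if l = ?k then Z $$ (i, l) * \<mu> (l div m) else 0)
      + (\<Sum>l<r * m. if l = Suc ?k then (if l mod m \<noteq> 0 then Z $$ (i, l) * c else 0) else 0)"
    unfolding sum.distrib[symmetric] by (rule sum.cong) auto
  also have "\<dots> = Z $$ (i, ?k) * \<mu> e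
      + (if Suc ?k < r * m \<and> Suc ?k mod m \<noteq> 0 then Z $$ (i, Suc ?k) * c else 0)"
    using lt by (simp add: div)
  also have "(Suc ?k < r * m \<and> Suc ?k mod m \<noteq> 0) \<longleftrightarrow> Suc k < m"
    using mod block_index_less[OF e, of "Suc k" m] by auto
  finally show ?thesis .
qed

lemma adjoint_bidiag_mult_index:
  assumes Z: "Z \<in> carrier_mat (r * m) t" and i: "i < t" and k: "k < m" and e: "e < r"
  shows "(mat_adjoint (bidiag r m \<mu> c) * Z) $$ (e * m + k, i) =
    cnj (\<mu> e) * Z $$ (e * m + k, i) + (if Suc k < m then cnj c * Z $$ (Suc (e * m + k), i) else 0)"
proof -
  have lt: "e * m + k < r * m" by (rule block_index_less[OF e k])
  have lt': "Suc k < m \<Longrightarrow> Suc (e * m + k) < r * m"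
    using block_index_less[OF e, of "Suc k" m] by simp
  have "mat_adjoint (bidiag r m \<mu> c) * Z = mat_adjoint (mat_adjoint Z * bidiag r m \<mu> c)"
    using mat_adjoint_mult[OF mat_adjoint_carrier[OF Z] bidiag_carrier] by simp
  then have "(mat_adjoint (bidiag r m \<mu> c) * Z) $$ (e * m + k, i)
      = cnj ((mat_adjoint Z * bidiag r m \<mu> c) $$ (i, e * m + k))"
    using Z i lt by (simp add: carrier_matD[OF bidiag_carrier])
  also have "\<dots> = cnj (\<mu> e) * Z $$ (e * m + k, i)
      + (if Suc k < m then cnj c * Z $$ (Suc (e * m + k), i) else 0)"
    using mult_bidiag_index[OF mat_adjoint_carrier[OF Z] i k e, of \<mu> c] Z i lt lt' by simp
  finally show ?thesis .
qed

text \<open>By lower triangularity, the row of the first nonzero entry of \<open>v\<close> involves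
  only that entry and its diagonal coefficient.\<close>

lemma bidiag_eigenvalue:
  assumes v: "v \<in> carrier_vec (r * m)" "v \<noteq> 0\<^sub>v (r * m)"
    and eig: "bidiag r m \<mu> c *\<^sub>v v = l \<cdot>\<^sub>v v"
  shows "\<exists>e<r. l = \<mu> e"
proof -
  have "\<exists>i. i < r * m \<and> v $ i \<noteq> 0" using v by (metis carrier_vecD eq_vecI index_zero_vec)
  define i where "i = (LEAST i. i < r * m \<and> v $ i \<noteq> 0)"
  have i: "i < r * m" "v $ i \<noteq> 0"
    using LeastI_ex[OF \<open>\<exists>i. _ i\<close>] by (auto simp: i_def)
  have least: "v $ k = 0" if "k < i" for k
    using not_less_Least[of k "\<lambda>i. i < r * m \<and> v $ i \<noteq> 0"] that i(1) by (auto simp: i_def)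
  have "l * v $ i = (bidiag r m \<mu> c *\<^sub>v v) $ i" using v i by (simp add: eig)
  also have "\<dots> = (\<Sum>k<r * m. (if i = k then \<mu> (i div m)
     else if i = Suc k \<and> i mod m \<noteq> 0 then c else 0) * v $ k)"
    using v i by (simp add: bidiag_def scalar_prod_def lessThan_atLeast0)
  also have "\<dots> = (\<Sum>k<r * m. if k = i then \<mu> (i div m) * v $ i else 0)"
    by (rule sum.cong) (auto simp: least)
  also have "\<dots> = \<mu> (i div m) * v $ i" using i by simp
  finally have "l = \<mu> (i div m)" using i by simp
  moreover have "i div m < r" using i by (simp add: less_mult_imp_div_less)
  ultimately show ?thesis by blast
qed

section \<open>The canonical blocks as an involution times a bidiagonal matrix\<close>

lemma F_mat_carrier [simp]: "F_mat m \<in> carrier_mat m m"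
  by (simp add: F_mat_def)

lemma G_mat_carrier [simp]: "G_mat m \<in> carrier_mat m m"
  by (simp add: G_mat_def)

lemma F_mat_mult:
  assumes "Z \<in> carrier_mat m t"
  shows "F_mat m * Z = mat m t (\<lambda>(i, k). Z $$ (m - 1 - i, k))"
proof (rule eq_matI)
  fix i k assume "i < dim_row (mat m t (\<lambda>(i, k). Z $$ (m - 1 - i, k)))"
    "k < dim_col (mat m t (\<lambda>(i, k). Z $$ (m - 1 - i, k)))"
  then have ik: "i < m" "k < t" by auto
  then have "(F_mat m * Z) $$ (i, k) = (\<Sum>l<m. (if i + l + 1 = m then 1 else 0) * Z $$ (l, k))"
    using assms by (simp add: F_mat_def scalar_prod_def lessThan_atLeast0)
  also have "\<dots> = (\<Sum>l<m. if l = m - 1 - i then Z $$ (l, k) else 0)"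
    by (rule sum.cong) (use ik in auto)
  also have "\<dots> = Z $$ (m - 1 - i, k)" using ik by simp
  finally show "(F_mat m * Z) $$ (i, k) = mat m t (\<lambda>(i, k). Z $$ (m - 1 - i, k)) $$ (i, k)"
    using ik by simp
qed (use assms in \<open>auto simp: F_mat_def\<close>)

lemma F_mat_squared: "F_mat m * F_mat m = 1\<^sub>m m"
  by (subst F_mat_mult[of _ m m]) (auto simp: F_mat_def intro!: eq_matI)

text \<open>Applying the involution \<open>Om\<close> to the pencil equation leaves an ordinary
  eigenvalue equation for the bidiagonal factor.\<close>

lemma pair_eigenvalue_of_factor:
  assumes Om: "Om \<in> carrier_mat (r * m) (r * m)" "Om * Om = 1\<^sub>m (r * m)"
    and La: "La = Om * bidiag r m \<mu> c" and l: "l \<in> pair_eigenvalues La Om"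
  shows "\<exists>e<r. l = \<mu> e"
proof -
  let ?J = "bidiag r m \<mu> c"
  obtain v where v: "v \<in> carrier_vec (r * m)" "v \<noteq> 0\<^sub>v (r * m)"
    and eq: "La *\<^sub>v v = l \<cdot>\<^sub>v (Om *\<^sub>v v)"
    using l Om unfolding pair_eigenvalues_def pair_eigenvector_def
    by (auto simp: La carrier_matD[OF bidiag_carrier])
  have Jv: "?J *\<^sub>v v \<in> carrier_vec (r * m)"
    by (rule mult_mat_vec_carrier[OF bidiag_carrier v(1)])
  have cancel: "Om *\<^sub>v (Om *\<^sub>v w) = w" if "w \<in> carrier_vec (r * m)" for w
    using assoc_mult_mat_vec[OF Om(1) Om(1) that] that by (simp add: Om)
  have "?J *\<^sub>v v = Om *\<^sub>v (La *\<^sub>v v)"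
    unfolding La assoc_mult_mat_vec[OF Om(1) bidiag_carrier v(1)] by (rule cancel[OF Jv, symmetric])
  also have "\<dots> = l \<cdot>\<^sub>v (Om *\<^sub>v (Om *\<^sub>v v))"
    unfolding eq by (rule mult_mat_vec[OF Om(1) mult_mat_vec_carrier[OF Om(1) v(1)]])
  also have "\<dots> = l \<cdot>\<^sub>v v" by (simp add: cancel v)
  finally show ?thesis by (rule bidiag_eigenvalue[OF v])
qed

lemma smult_mult_mat_vec:
  fixes A :: "'a :: comm_semiring_0 mat"
  assumes "A \<in> carrier_mat r c" "v \<in> carrier_vec c"
  shows "(a \<cdot>\<^sub>m A) *\<^sub>v v = a \<cdot>\<^sub>v (A *\<^sub>v v)"
  using assms by (intro eq_vecI) (auto simp: scalar_prod_def sum_distrib_left mult.assoc)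

lemma signed_F_mat:
  fixes \<eta> :: real and m :: nat
  assumes "\<eta> \<in> {1, - 1}"
  defines "Om \<equiv> of_real \<eta> \<cdot>\<^sub>m F_mat m"
  shows "Om \<in> carrier_mat m m" "Om * Om = 1\<^sub>m m" "mat_adjoint Om = Om"
proof -
  show "Om \<in> carrier_mat m m" by (simp add: Om_def)
  have "Om * Om = of_real \<eta> \<cdot>\<^sub>m (of_real \<eta> \<cdot>\<^sub>m (F_mat m * F_mat m))"
    unfolding Om_def
    by (simp add: mult_smult_distrib[of _ m m _ m] mult_smult_assoc_mat[of _ m m _ m])
  then show "Om * Om = 1\<^sub>m m" using assms(1) by (auto simp: F_mat_squared intro!: eq_matI)
  show "mat_adjoint Om = Om" by (rule eq_matI) (auto simp: Om_def F_mat_def add.commute)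
qed

text \<open>\<open>F_mat\<close> reverses the rows, so it turns \<open>F_mat\<close> into the
  identity and \<open>G_mat\<close> into the lower shift; the anti-triangular blocks become
  bidiagonal. A nonzero finite eigenvalue rules out R1 and R2.\<close>

lemma canonical_block_factor:
  assumes wf: "block_wf b" and l: "l \<in> pair_eigenvalues (block_Lambda b) (block_Omega b)" "l \<noteq> 0"
  obtains r \<mu> where "block_size b = r * index b" "0 < index b"
    "block_Omega b * block_Omega b = 1\<^sub>m (block_size b)"
    "mat_adjoint (block_Omega b) = block_Omega b"
    "block_Lambda b = block_Omega b * bidiag r (index b) \<mu> (cmod l)"
    "\<And>e. e < r \<Longrightarrow> \<mu> e \<in> {l, cnj l}"
proof -
  note conclude = that
  \<comment> \<open>R2 and R3 in one form, R2 being \<alpha> = 0 with c = 1. The eigenvalue is then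
    \<open>of_real \<alpha>\<close>, so \<open>l \<noteq> 0\<close> excludes R2 and gives c =
    |\<alpha>| = |l|.\<close>
  have real: thesis if b: "block_Omega b = of_real \<eta> \<cdot>\<^sub>m F_mat m" "block_size b = m" "index b = m"
      "block_Lambda b = of_real \<eta> \<cdot>\<^sub>m (of_real \<alpha> \<cdot>\<^sub>m F_mat m + of_real c \<cdot>\<^sub>m G_mat m)"
      "\<eta> \<in> {1, - 1}" "1 \<le> m" "\<alpha> \<noteq> 0 \<Longrightarrow> c = \<bar>\<alpha>\<bar>" for \<eta> m \<alpha> c
  proof -
    note Om = signed_F_mat[OF b(5), of m]
    have J: "bidiag 1 m (\<lambda>_. of_real \<alpha>) (of_real c) \<in> carrier_mat m m"
      using bidiag_carrier[of 1 m] by simp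
    have La: "block_Lambda b = block_Omega b * bidiag 1 m (\<lambda>_. of_real \<alpha>) (of_real c)"
      unfolding b mult_smult_assoc_mat[OF F_mat_carrier J] F_mat_mult[OF J]
      by (auto simp: bidiag_def F_mat_def G_mat_def intro!: eq_matI)
    have "l = of_real \<alpha>"
      using pair_eigenvalue_of_factor[of "block_Omega b" 1 m, OF _ _ La l(1)] Om by (auto simp: b)
    then show ?thesis
      using conclude[of 1 "\<lambda>_. of_real \<alpha>"] b Om La l(2) by auto
  qed
  show ?thesis
  proof (cases b)
    case (R1 \<delta> k)
    obtain v where v: "v \<in> carrier_vec k" "v \<noteq> 0\<^sub>v k"
      and eq: "(of_real \<delta> \<cdot>\<^sub>m F_mat k) *\<^sub>v v = l \<cdot>\<^sub>v ((of_real \<delta> \<cdot>\<^sub>m G_mat k) *\<^sub>v v)"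
      using l(1) R1 unfolding pair_eigenvalues_def pair_eigenvector_def
      by (auto simp: F_mat_def)
    have \<delta>: "\<delta> \<in> {1, - 1}" "1 \<le> k" using wf R1 by auto
    note Om = signed_F_mat[OF \<delta>(1), of k]
    let ?F = "of_real \<delta> \<cdot>\<^sub>m F_mat k" and ?G = "of_real \<delta> \<cdot>\<^sub>m G_mat k"
    have G: "?G \<in> carrier_mat k k" by simp
    have "v = (?F * ?F) *\<^sub>v v" using v by (simp add: Om)
    also have "\<dots> = ?F *\<^sub>v (l \<cdot>\<^sub>v (?G *\<^sub>v v))"
      unfolding assoc_mult_mat_vec[OF Om(1) Om(1) v(1)] by (simp only: eq)
    also have "\<dots> = l \<cdot>\<^sub>v (?F *\<^sub>v (?G *\<^sub>v v))"
      by (rule mult_mat_vec[OF Om(1) mult_mat_vec_carrier[OF G v(1)]])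
    also have "\<dots> = l \<cdot>\<^sub>v ((?F * ?G) *\<^sub>v v)"
      unfolding assoc_mult_mat_vec[OF Om(1) G v(1)] by simp
    also have "\<dots> = (l \<cdot>\<^sub>m (?F * ?G)) *\<^sub>v v"
      by (rule smult_mult_mat_vec[OF mult_carrier_mat[OF Om(1) G] v(1), symmetric])
    also have "l \<cdot>\<^sub>m (?F * ?G) = bidiag 1 k (\<lambda>_. 0) l"
      using \<delta>
      by (subst mult_smult_assoc_mat[of _ k k _ k])
        (auto simp: F_mat_mult[of _ k k] bidiag_def G_mat_def intro!: eq_matI)
    \<comment> \<open>For R1 a finite eigenvalue would make 1 an eigenvalue of a nilpotent matrix,
      namely \<open>l\<close> times the lower shift.\<close>
    finally have "bidiag 1 k (\<lambda>_. 0) l *\<^sub>v v = 1 \<cdot>\<^sub>v v" by simp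
    then have False using bidiag_eigenvalue[of v 1 k "\<lambda>_. 0" l 1] v by auto
    then show ?thesis ..
  next
    case (R2 \<eta> m)
    then show ?thesis using wf by (intro real[of \<eta> m 0 1]) (auto intro!: eq_matI simp: F_mat_def G_mat_def)
  next
    case (R3 \<eta> m \<alpha>)
    then show ?thesis using wf by (intro real[of \<eta> m \<alpha> "\<bar>\<alpha>\<bar>"]) auto
  next
    case (R4 m \<beta>)
    \<comment> \<open>Reversing all 2 m rows brings the lower half of the block to the top, so the
      conjugate of \<open>\<beta>\<close> comes first on the diagonal.\<close>
    let ?\<mu> = "\<lambda>e. if e = 0 then cnj \<beta> else \<beta>"
    have Om: "F_mat (2 * m) \<in> carrier_mat (2 * m) (2 * m)" "F_mat (2 * m) * F_mat (2 * m) = 1\<^sub>m (2 * m)"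
      "mat_adjoint (F_mat (2 * m)) = F_mat (2 * m)"
    proof -
      have "1 \<cdot>\<^sub>m F_mat (2 * m) = F_mat (2 * m)" by (rule eq_matI) auto
      then show "F_mat (2 * m) \<in> carrier_mat (2 * m) (2 * m)"
        "F_mat (2 * m) * F_mat (2 * m) = 1\<^sub>m (2 * m)" "mat_adjoint (F_mat (2 * m)) = F_mat (2 * m)"
        using signed_F_mat[of 1 "2 * m"] by simp_all
    qed
    have m: "1 \<le> m" using wf R4 by simp
    have La: "block_Lambda b = block_Omega b * bidiag 2 m ?\<mu> (of_real (cmod \<beta>))"
    proof -
      have upper: "(2 * m - 1 - i) div m = 1" "(2 * m - 1 - i) mod m = m - 1 - i" if "i < m" for i
      proof -
        have i: "2 * m - 1 - i = m + (m - 1 - i)" using that by simp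
        have "m - 1 - i < m" using that by simp
        then show "(2 * m - 1 - i) div m = 1" "(2 * m - 1 - i) mod m = m - 1 - i"
          unfolding i by (simp_all add: div_add_self1 del: diff_diff_left add_diff_assoc)
      qed
      have lower: "(2 * m - 1 - i) div m = 0" "(2 * m - 1 - i) mod m = 2 * m - 1 - i" if "m \<le> i" for i
        using that m by auto
      show ?thesis
      proof (rule eq_matI)
        fix i k assume "i < dim_row (block_Omega b * bidiag 2 m ?\<mu> (of_real (cmod \<beta>)))"
          "k < dim_col (block_Omega b * bidiag 2 m ?\<mu> (of_real (cmod \<beta>)))"
        then have ik: "i < 2 * m" "k < 2 * m" by (auto simp: R4 F_mat_def bidiag_def)
        define i' where "i' = 2 * m - 1 - i"
        have i': "i' < 2 * m" "i' div m = (if i < m then 1 else 0)"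
          "i' mod m = 0 \<longleftrightarrow> (if i < m then i + 1 = m else i + 1 = 2 * m)"
          using upper[of i] lower[of i] ik by (auto simp: i'_def)
        have "(block_Omega b * bidiag 2 m ?\<mu> (of_real (cmod \<beta>))) $$ (i, k)
          = bidiag 2 m ?\<mu> (of_real (cmod \<beta>)) $$ (i', k)"
          using ik by (simp add: R4 F_mat_mult[OF bidiag_carrier] i'_def)
        also have "\<dots> = (if i' = k then if i < m then \<beta> else cnj \<beta>
            else if i' = Suc k \<and> \<not> (if i < m then i + 1 = m else i + 1 = 2 * m)
              then of_real (cmod \<beta>) else 0)"
        proof -
          have "bidiag 2 m ?\<mu> (of_real (cmod \<beta>)) $$ (i', k) = (if i' = k then ?\<mu> (i' div m)
            else if i' = Suc k \<and> i' mod m \<noteq> 0 then of_real (cmod \<beta>) else 0)"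
            using i'(1) ik by (simp add: bidiag_def)
          then show ?thesis unfolding i'(2,3) by (cases "i < m") simp_all
        qed
        also have "\<dots> = block_Lambda b $$ (i, k)"
          using ik by (cases "i < m"; cases "k < m") (auto simp: R4 F_mat_def G_mat_def i'_def)
        finally show "block_Lambda b $$ (i, k)
          = (block_Omega b * bidiag 2 m ?\<mu> (of_real (cmod \<beta>))) $$ (i, k)" by simp
      qed (auto simp: R4 F_mat_def G_mat_def bidiag_def)
    qed
    have "\<exists>e<2::nat. l = ?\<mu> e"
      using pair_eigenvalue_of_factor[OF _ _ La l(1)] Om(1,2) by (simp add: R4)
    then have l\<beta>: "l = \<beta> \<or> l = cnj \<beta>" by (auto split: if_splits)
    show ?thesis
      using that[of 2 ?\<mu>] l\<beta> La Om m by (auto simp: R4)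
  qed
qed

section \<open>The perturbation bounds\<close>

lemma spectral_norm_isometry_le:
  assumes E: "E \<in> carrier_mat N s" and EE: "mat_adjoint E * E = 1\<^sub>m s"
  shows "spectral_norm E \<le> 1"
proof (rule spectral_norm_least[OF E])
  fix v :: "complex vec" assume v: "v \<in> carrier_vec s"
  have Ev: "E *\<^sub>v v \<in> carrier_vec N" using E v by auto
  have "(E *\<^sub>v v) \<bullet>c (E *\<^sub>v v) = v \<bullet>c v"
    using assoc_mult_mat_vec[OF mat_adjoint_carrier[OF E] E v] v
    by (simp add: cscalar_prod_adjoint[OF E v Ev] EE)
  then have "(vec_norm2 (E *\<^sub>v v))\<^sup>2 = (vec_norm2 v)\<^sup>2"
    unfolding cscalar_prod_self of_real_eq_iff .
  then show "vec_norm2 (E *\<^sub>v v) \<le> 1 * vec_norm2 v" by simp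
qed simp

text \<open>Cancelling X^H gives B X_j = X^-H E \<Omega>_j and A X_j = X^-H E \<Lambda>_j, and
  \<Lambda>_j = \<Omega>_j J. Both \<open>E\<close> and the Hermitian involution \<Omega>_j have
  norm at most 1, so only the norm of the inverse of \<open>X\<close> remains.\<close>

lemma canonical_decomposition_block_factor:
  assumes dec: "canonical_decomposition N A B X Xs bs" and j: "j < length bs"
    and A: "A \<in> carrier_mat N N" and B: "B \<in> carrier_mat N N"
    and l: "l \<in> pair_eigenvalues (block_Lambda (bs ! j)) (block_Omega (bs ! j))" "l \<noteq> 0"
  obtains r \<mu> where "0 < index (bs ! j)" "Xs ! j \<in> carrier_mat N (r * index (bs ! j))"
    "A * (Xs ! j) = B * (Xs ! j) * bidiag r (index (bs ! j)) \<mu> (cmod l)"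
    "\<And>e. e < r \<Longrightarrow> \<mu> e \<in> {l, cnj l}"
    "spectral_norm (B * (Xs ! j)) \<le> spectral_norm (mat_inv X)"
    "spectral_norm (Xs ! j) \<le> spectral_norm X"
proof -
  define b where "b = bs ! j"
  have wf: "block_wf b" and X: "X \<in> carrier_mat N N" and inv: "invertible_mat X"
    using dec j unfolding canonical_decomposition_def b_def by auto
  obtain r \<mu> where r: "block_size b = r * index b" "0 < index b"
    and OO: "block_Omega b * block_Omega b = 1\<^sub>m (block_size b)"
    and Oh: "mat_adjoint (block_Omega b) = block_Omega b"
    and La: "block_Lambda b = block_Omega b * bidiag r (index b) \<mu> (cmod l)"
    and \<mu>: "\<And>e. e < r \<Longrightarrow> \<mu> e \<in> {l, cnj l}"
    using canonical_block_factor[OF wf l[folded b_def]] by metis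
  obtain E where E: "E \<in> carrier_mat N (block_size b)"
    and EE: "mat_adjoint E * E = 1\<^sub>m (block_size b)" and Xj: "Xs ! j = X * E"
    and AE: "(mat_adjoint X * A * X) * E = E * block_Lambda b"
    and BE: "(mat_adjoint X * B * X) * E = E * block_Omega b"
    using canonical_decomposition_block[OF dec j, folded b_def] by metis
  define s where "s = block_size b"
  define Y where "Y = mat_inv X"
  define J where "J = bidiag r (index b) \<mu> (cmod l)"
  note Xinv = mat_inv[OF X inv, folded Y_def]
  have J: "J \<in> carrier_mat s s" using bidiag_carrier[of r "index b" \<mu> "cmod l"] r by (simp add: J_def s_def)
  have O: "block_Omega b \<in> carrier_mat s s" by (simp add: block_carrier s_def)
  have E': "E \<in> carrier_mat N s" using E by (simp add: s_def)
  have Xa: "mat_adjoint X \<in> carrier_mat N N" and Ya: "mat_adjoint Y \<in> carrier_mat N N"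
    using X Xinv by auto
  have YX: "mat_adjoint Y * mat_adjoint X = 1\<^sub>m N"
    using mat_adjoint_mult[OF X Xinv(1)] by (simp add: Xinv)
  have cancel: "C * (X * E) = mat_adjoint Y * D"
    if C: "C \<in> carrier_mat N N" and D: "(mat_adjoint X * C * X) * E = D" for C D
  proof -
    have XE: "X * E \<in> carrier_mat N s" using X E' by (rule mult_carrier_mat)
    have "D = mat_adjoint X * (C * (X * E))"
      unfolding D[symmetric] using Xa C X E' by (simp add: assoc_mult_mat[of _ N N _ N _ s] assoc_mult_mat[of _ N N _ N _ N])
    then have "mat_adjoint Y * D = (mat_adjoint Y * mat_adjoint X) * (C * (X * E))"
      using assoc_mult_mat[OF Ya Xa mult_carrier_mat[OF C XE]] by simp
    also have "\<dots> = C * (X * E)" unfolding YX by (rule left_mult_one_mat[OF mult_carrier_mat[OF C XE]])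
    finally show ?thesis by simp
  qed
  have BX: "B * (Xs ! j) = mat_adjoint Y * (E * block_Omega b)"
    unfolding Xj by (rule cancel[OF B BE])
  have "A * (Xs ! j) = mat_adjoint Y * (E * (block_Omega b * J))"
    unfolding Xj J_def La[symmetric] by (rule cancel[OF A AE])
  also have "\<dots> = B * (Xs ! j) * J"
    unfolding BX using Ya E' O J
    by (simp add: assoc_mult_mat[of _ N N _ s _ s] assoc_mult_mat[of _ N s _ s _ s] del: assoc_mult_mat)
  finally have AX: "A * (Xs ! j) = B * (Xs ! j) * J" .
  have "spectral_norm E \<le> 1" by (rule spectral_norm_isometry_le[OF E EE])
  moreover have "spectral_norm (block_Omega b) \<le> 1"
    by (rule spectral_norm_isometry_le[OF O]) (simp add: Oh OO s_def)
  ultimately have EO: "spectral_norm (E * block_Omega b) \<le> 1"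
    using spectral_norm_mult[OF E' O] mult_le_one[of "spectral_norm E" "spectral_norm (block_Omega b)"] by auto
  have "spectral_norm (B * (Xs ! j)) \<le> spectral_norm (mat_adjoint Y) * spectral_norm (E * block_Omega b)"
    unfolding BX by (rule spectral_norm_mult[OF Ya mult_carrier_mat[OF E' O]])
  also have "\<dots> \<le> spectral_norm Y * 1"
    using EO by (intro mult_mono spectral_norm_adjoint_le[OF Xinv(1)]) auto
  finally have nB: "spectral_norm (B * (Xs ! j)) \<le> spectral_norm (mat_inv X)" by (simp add: Y_def)
  have "spectral_norm (Xs ! j) \<le> spectral_norm X * spectral_norm E"
    unfolding Xj by (rule spectral_norm_mult[OF X E])
  also have "\<dots> \<le> spectral_norm X * 1"
    using \<open>spectral_norm E \<le> 1\<close> by (intro mult_left_mono) auto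
  finally have nX: "spectral_norm (Xs ! j) \<le> spectral_norm X" by simp
  have "Xs ! j \<in> carrier_mat N (r * index b)" unfolding Xj r(1)[symmetric] using X E by (rule mult_carrier_mat)
  then show ?thesis
    using that[of r \<mu>] r(2) AX \<mu> nB nX unfolding b_def J_def by blast
qed

text \<open>For points of the closed upper half plane, reflecting one of them across the real axis
  cannot bring them closer, and reflecting both preserves the distance.\<close>

lemma cmod_diff_cnj_ge:
  assumes "0 \<le> Im l" "0 \<le> Im lt" "\<mu> \<in> {l, cnj l}" "\<nu> \<in> {lt, cnj lt}"
  shows "cmod (lt - l) \<le> cmod (\<nu> - \<mu>)"
proof -
  have 1: "cmod (lt - l) \<le> cmod (lt - cnj l)"
    unfolding cmod_def using assms(1,2) by (intro real_sqrt_le_mono add_mono) (auto intro!: power_mono simp: abs_le_iff power2_eq_square algebra_simps)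
  have 2: "cmod (cnj lt - cnj l) = cmod (lt - l)"
    by (metis complex_cnj_diff complex_mod_cnj)
  have 3: "cmod (cnj lt - l) = cmod (lt - cnj l)"
    by (metis complex_cnj_diff complex_mod_cnj complex_cnj_cnj)
  show ?thesis using assms(3,4) 1 2 3 by auto
qed

section \<open>The Sylvester equation for a pair of canonical blocks\<close>

lemma sum_mult_blocks:
  fixes h :: "nat \<Rightarrow> 'a :: comm_monoid_add"
  shows "(\<Sum>i<r * m. h i) = (\<Sum>e<r. \<Sum>i<m. h (e * m + i))"
  by (induction r) (simp_all add: sum_lessThan_add add.commute[of m])

text \<open>Both coefficients are block diagonal, so each m by k block of \<open>Y\<close> satisfies
  its own equation. Squared Frobenius norms add over these blocks, and the constants are the same
  for all of them, so the bounds can simply be summed.\<close>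

lemma sylvester_matrix_bound:
  fixes Y P Q :: "complex mat" and l lt :: complex
  assumes m: "0 < m" and k: "0 < k"
    and carr: "Y \<in> carrier_mat (r * m) (s * k)" "P \<in> carrier_mat (r * m) (s * k)" "Q \<in> carrier_mat (r * m) (s * k)"
    and \<mu>: "\<And>e. e < r \<Longrightarrow> \<mu> e \<in> {l, cnj l}" and \<nu>: "\<And>e. e < s \<Longrightarrow> \<nu> e \<in> {lt, cnj lt}"
    and J: "J = bidiag r m \<mu> (cmod l)" and Jt: "Jt = bidiag s k \<nu> (cmod lt)"
    and eq: "Y * Jt + Q * Jt = mat_adjoint J * Y + mat_adjoint J * P"
    and Im: "0 \<le> Im l" "0 \<le> Im lt" and ne: "l \<noteq> lt"
    and small: "3 * cmod (lt - l) \<le> cmod l" "3 * cmod (lt - l) \<le> cmod lt"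
  defines "g \<equiv> cmod (lt - l) / cmod l" and "gt \<equiv> cmod (lt - l) / cmod lt"
  shows "(g ^ m * gt ^ k)\<^sup>2 * (frobenius_norm Y)\<^sup>2
    \<le> 4 * (g\<^sup>2 + gt\<^sup>2) * ((real ((k + m - 1) choose m))\<^sup>2 * (frobenius_norm P)\<^sup>2
        + (real ((k + m - 1) choose k))\<^sup>2 * (frobenius_norm Q)\<^sup>2)"
proof -
  define sub where "sub Z e f i j = (if i < m \<and> j < k then Z $$ (e * m + i, f * k + j) else 0)"
    for Z :: "complex mat" and e f i j
  define S where "S Z e f = (\<Sum>i<m. \<Sum>j<k. (cmod (sub Z e f i j))\<^sup>2)" for Z e f
  have frob: "(frobenius_norm Z)\<^sup>2 = (\<Sum>e<r. \<Sum>f<s. S Z e f)" if "Z \<in> carrier_mat (r * m) (s * k)" for Z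
  proof -
    have "(frobenius_norm Z)\<^sup>2
        = (\<Sum>e<r. \<Sum>i<m. \<Sum>f<s. \<Sum>j<k. (cmod (Z $$ (e * m + i, f * k + j)))\<^sup>2)"
      using that by (simp add: frobenius_norm_power2 sum_mult_blocks)
    also have "\<dots> = (\<Sum>e<r. \<Sum>f<s. \<Sum>i<m. \<Sum>j<k. (cmod (Z $$ (e * m + i, f * k + j)))\<^sup>2)"
      by (rule sum.cong[OF refl], rule sum.swap)
    also have "\<dots> = (\<Sum>e<r. \<Sum>f<s. S Z e f)"
      by (simp add: S_def sub_def)
    finally show ?thesis .
  qed
  have "(g ^ m * gt ^ k)\<^sup>2 * S Y e f
    \<le> 4 * (g\<^sup>2 + gt\<^sup>2) * ((real ((k + m - 1) choose m))\<^sup>2 * S P e f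
        + (real ((k + m - 1) choose k))\<^sup>2 * S Q e f)" if e: "e < r" and f: "f < s" for e f
    unfolding S_def g_def gt_def
  \<comment> \<open>The left coefficient is the adjoint of \<open>J\<close>, hence the conjugate of
    \<open>\<mu> e\<close>; this is again \<open>l\<close> or its conjugate.\<close>
  proof (rule sylvester_block_bound[where \<mu> = "cnj (\<mu> e)" and \<nu> = "\<nu> f"])
    show "0 < cmod (lt - l)" using ne by simp
    show "cmod (lt - l) \<le> cmod (\<nu> f - cnj (\<mu> e))"
      using \<mu>[OF e] \<nu>[OF f] by (intro cmod_diff_cnj_ge[OF Im]) auto
    show "cmod (cnj (\<mu> e)) = cmod l" "cmod (\<nu> f) = cmod lt" using \<mu>[OF e] \<nu>[OF f] by auto
    show "sub Y e f i j = 0 \<and> sub P e f i j = 0 \<and> sub Q e f i j = 0" if "m \<le> i \<or> k \<le> j" for i j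
      using that by (auto simp: sub_def)
    fix i j assume i: "i < m" and j: "j < k"
    have I: "e * m + i < r * m" "f * k + j < s * k"
      using block_index_less e f i j by auto
    have R: "(Z * Jt) $$ (e * m + i, f * k + j)
        = sub Z e f i j * \<nu> f + of_real (cmod lt) * sub Z e f i (Suc j)"
      if "Z \<in> carrier_mat (r * m) (s * k)" for Z
      unfolding Jt mult_bidiag_index[OF that I(1) j f] using i j by (simp add: sub_def)
    have L: "(mat_adjoint J * Z) $$ (e * m + i, f * k + j)
        = cnj (\<mu> e) * sub Z e f i j + of_real (cmod l) * sub Z e f (Suc i) j"
      if "Z \<in> carrier_mat (r * m) (s * k)" for Z
      unfolding J adjoint_bidiag_mult_index[OF that I(2) i e] using i j by (simp add: sub_def)
    have dims: "dim_row J = r * m" "dim_col J = r * m" "dim_row Jt = s * k" "dim_col Jt = s * k"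
      by (simp_all add: J Jt bidiag_def)
    have "(Y * Jt) $$ (e * m + i, f * k + j) + (Q * Jt) $$ (e * m + i, f * k + j)
      = (mat_adjoint J * Y) $$ (e * m + i, f * k + j) + (mat_adjoint J * P) $$ (e * m + i, f * k + j)"
      using arg_cong[OF eq, of "\<lambda>Z. Z $$ (e * m + i, f * k + j)"] I carr dims by auto
    then show "(\<nu> f - cnj (\<mu> e)) * sub Y e f i j
      = of_real (cmod l) * sub Y e f (Suc i) j - of_real (cmod lt) * sub Y e f i (Suc j)
        + cnj (\<mu> e) * sub P e f i j + of_real (cmod l) * sub P e f (Suc i) j
        - \<nu> f * sub Q e f i j - of_real (cmod lt) * sub Q e f i (Suc j)"
      unfolding R[OF carr(1)] R[OF carr(3)] L[OF carr(1)] L[OF carr(2)] by (simp add: algebra_simps)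
  qed (use m k small in auto)
  then have "(\<Sum>e<r. \<Sum>f<s. (g ^ m * gt ^ k)\<^sup>2 * S Y e f)
    \<le> (\<Sum>e<r. \<Sum>f<s. 4 * (g\<^sup>2 + gt\<^sup>2) * ((real ((k + m - 1) choose m))\<^sup>2 * S P e f
        + (real ((k + m - 1) choose k))\<^sup>2 * S Q e f))"
    by (intro sum_mono) auto
  then show ?thesis
    unfolding frob[OF carr(1)] frob[OF carr(2)] frob[OF carr(3)]
    by (simp add: sum_distrib_left[symmetric] sum.distrib)
qed

section \<open>The linearized pairs and their relative perturbations\<close>

lemma hermitian_matD:
  assumes "hermitian_mat A" "A \<in> carrier_mat k k" "i < k" "j < k"
  shows "cnj (A $$ (i, j)) = A $$ (j, i)"
  using assms index_mat_adjoint[of j A i] unfolding hermitian_mat_def by auto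

lemma hermitian_four_block:
  assumes "A \<in> carrier_mat k k" "B \<in> carrier_mat k k" "D \<in> carrier_mat k k"
    and "hermitian_mat A" "hermitian_mat B" "hermitian_mat D"
  shows "mat_adjoint (four_block_mat A B B D) = four_block_mat A B B D"
  using assms by (intro eq_matI) (auto simp: hermitian_matD)

text \<open>The correction factors are verified by multiplication, so neither linearization has to
  be inverted. The zero block of B makes the factor for B lower triangular with \<open>D\<close>
  twice on the diagonal.\<close>

lemma linearization_perturbation:
  fixes M C K dM dC dK :: "complex mat"
  assumes c: "M \<in> carrier_mat n n" "C \<in> carrier_mat n n" "K \<in> carrier_mat n n"
      "dM \<in> carrier_mat n n" "dC \<in> carrier_mat n n" "dK \<in> carrier_mat n n"
    and inv: "invertible_mat M" "invertible_mat K"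
  defines "D \<equiv> mat_inv M * dM" and "Z \<equiv> mat_inv M * dC - mat_inv M * C * mat_inv M * dM"
    and "U \<equiv> mat_inv K * dK"
  shows "D \<in> carrier_mat n n" "Z \<in> carrier_mat n n" "U \<in> carrier_mat n n"
    "four_block_mat (- (K + dK)) (0\<^sub>m n n) (0\<^sub>m n n) (M + dM)
      = four_block_mat (- K) (0\<^sub>m n n) (0\<^sub>m n n) M
        + four_block_mat (- K) (0\<^sub>m n n) (0\<^sub>m n n) M * four_block_mat U (0\<^sub>m n n) (0\<^sub>m n n) D"
    "four_block_mat (C + dC) (M + dM) (M + dM) (0\<^sub>m n n)
      = four_block_mat C M M (0\<^sub>m n n) + four_block_mat C M M (0\<^sub>m n n) * four_block_mat D (0\<^sub>m n n) Z D"
proof -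
  note M' = mat_inv[OF c(1) inv(1)] and K' = mat_inv[OF c(3) inv(2)]
  show carr: "D \<in> carrier_mat n n" "Z \<in> carrier_mat n n" "U \<in> carrier_mat n n"
    using c M' K' unfolding D_def Z_def U_def by (auto intro!: minus_carrier_mat mult_carrier_mat)
  have cancel: "A * (A' * E) = E"
    if "A \<in> carrier_mat n n" "A' \<in> carrier_mat n n" "E \<in> carrier_mat n n" "A * A' = 1\<^sub>m n"
    for A A' E :: "complex mat"
    using assoc_mult_mat[OF that(1,2,3)] that by simp
  have MD: "M * D = dM" unfolding D_def by (rule cancel[OF c(1) M'(1) c(4) M'(2)])
  have KU: "K * U = dK" unfolding U_def by (rule cancel[OF c(3) K'(1) c(6) K'(2)])
  have CD: "C * D \<in> carrier_mat n n" using c carr by auto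
  have Z': "Z = mat_inv M * dC - mat_inv M * (C * D)"
    unfolding Z_def D_def using c M'
    by (simp add: assoc_mult_mat[of _ n n _ n _ n])
  \<comment> \<open>\<open>Z\<close> is the solution of C D + M Z = dC, the upper left block of the
    perturbation of B; this is where its minus sign comes from.\<close>
  have MZ: "M * Z = dC - C * D"
    unfolding Z' using c M' CD
    by (subst mult_minus_distrib_mat[of _ n n _ n])
      (auto simp: cancel[OF c(1) M'(1) _ M'(2)])
  have m0: "- K * 0\<^sub>m n n = 0\<^sub>m n n" "M * 0\<^sub>m n n = 0\<^sub>m n n" "C * 0\<^sub>m n n = 0\<^sub>m n n"
    "0\<^sub>m n n * U = 0\<^sub>m n n" "0\<^sub>m n n * D = 0\<^sub>m n n" "0\<^sub>m n n * Z = 0\<^sub>m n n"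
    using c carr by auto
  have KU': "- K * U = - dK" using KU c carr by (metis uminus_mult_left_mat carrier_matD)
  show "four_block_mat (- (K + dK)) (0\<^sub>m n n) (0\<^sub>m n n) (M + dM)
      = four_block_mat (- K) (0\<^sub>m n n) (0\<^sub>m n n) M
        + four_block_mat (- K) (0\<^sub>m n n) (0\<^sub>m n n) M * four_block_mat U (0\<^sub>m n n) (0\<^sub>m n n) D"
    using c carr
    by (subst mult_four_block_mat[of _ n n _ n _ n _ _ n _ n])
      (auto simp: m0 KU' MD intro!: eq_matI)
  show "four_block_mat (C + dC) (M + dM) (M + dM) (0\<^sub>m n n)
      = four_block_mat C M M (0\<^sub>m n n) + four_block_mat C M M (0\<^sub>m n n) * four_block_mat D (0\<^sub>m n n) Z D"
    using c carr CD
    by (subst mult_four_block_mat[of _ n n _ n _ n _ _ n _ n])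
      (auto simp: m0 MZ MD intro!: eq_matI)
qed

theorem theorem4p2:
  fixes n :: nat
    and M C K dM dC dK Mt Ct Kt A B At Bt dB X Xt :: "complex mat"
    and Xs Xts :: "complex mat list"
    and bs bts :: "canonical_block list"
    and j jt nj njt :: nat
    and l lt :: complex
    and \<gamma> \<gamma>t \<kappa> :: real
  assumes dims: "M \<in> carrier_mat n n" "C \<in> carrier_mat n n" "K \<in> carrier_mat n n"
      "dM \<in> carrier_mat n n" "dC \<in> carrier_mat n n" "dK \<in> carrier_mat n n"
    and perturbed: "Mt = M + dM" "Ct = C + dC" "Kt = K + dK"
    and herm: "hermitian_mat M" "hermitian_mat C" "hermitian_mat K"
      "hermitian_mat Mt" "hermitian_mat Ct" "hermitian_mat Kt"
    and nonsing: "invertible_mat M" "invertible_mat K" "invertible_mat Mt" "invertible_mat Kt"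
    and A: "A = four_block_mat (- K) (0\<^sub>m n n) (0\<^sub>m n n) M"
    and B: "B = four_block_mat C M M (0\<^sub>m n n)"
    and At: "At = four_block_mat (- Kt) (0\<^sub>m n n) (0\<^sub>m n n) Mt"
    and Bt: "Bt = four_block_mat Ct Mt Mt (0\<^sub>m n n)"
    and dB: "dB = Bt - B"
    and decomp: "canonical_decomposition (2 * n) A B X Xs bs"
    and decompt: "canonical_decomposition (2 * n) At Bt Xt Xts bts"
    and j: "j < length bs" and jt: "jt < length bts"
    and nj: "nj = index (bs ! j)" and njt: "njt = index (bts ! jt)"
    and l: "l \<in> pair_eigenvalues (block_Lambda (bs ! j)) (block_Omega (bs ! j))" "l \<noteq> 0" "0 \<le> Im l"
    and lt: "lt \<in> pair_eigenvalues (block_Lambda (bts ! jt)) (block_Omega (bts ! jt))" "lt \<noteq> 0" "0 \<le> Im lt"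
    and \<gamma>: "\<gamma> = cmod ((lt - l) / l)" and \<gamma>t: "\<gamma>t = cmod ((lt - l) / lt)"
    and \<kappa>: "\<kappa> = spectral_norm (mat_inv X) * spectral_norm Xt"
  shows "(\<forall>u ut x xt \<delta>a \<delta>b \<delta>c \<delta>d.
            nj = 1 \<and> njt = 1 \<and>
            u \<in> set (cols (Xs ! j)) \<and> pair_eigenvector A B u l \<and>
            ut \<in> set (cols (Xts ! jt)) \<and> pair_eigenvector At Bt ut lt \<and>
            qep_eigenvector M C K x l \<and> u = x @\<^sub>v (l \<cdot>\<^sub>v x) \<and>
            qep_eigenvector Mt Ct Kt xt lt \<and> ut = xt @\<^sub>v (lt \<cdot>\<^sub>v xt) \<and>
            cmod ((B *\<^sub>v ut) \<bullet>c u) > \<kappa> * spectral_norm (mat_inv B * dB) \<and>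
            \<delta>a = max (spectral_norm (mat_inv K * dK)) (spectral_norm (mat_inv M * dM)) \<and>
            \<delta>b = spectral_norm (mat_inv M * dM) \<and>
            \<delta>c = spectral_norm (mat_inv M * dC) + spectral_norm (mat_inv M * C * mat_inv M * dM) \<and>
            \<delta>d = cmod ((C *\<^sub>v xt) \<bullet>c x + (lt + cnj l) * ((M *\<^sub>v xt) \<bullet>c x))
            \<longrightarrow> 0 < \<delta>d - \<kappa> * (\<delta>b + \<delta>c)
            \<longrightarrow> \<gamma> \<le> \<kappa> * (\<delta>a + \<delta>b + \<delta>c) / (\<delta>d - \<kappa> * (\<delta>b + \<delta>c)))
       \<and> (\<forall>Xl Xlt \<delta>aF \<delta>bF.
            \<gamma> \<le> (5 - sqrt 17) / 4 \<and> \<gamma>t \<le> (5 - sqrt 17) / 4 \<and>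
            Xl = Xs ! j \<and> Xlt = Xts ! jt \<and>
            l \<noteq> lt \<and> mat_adjoint Xl * B * Xlt \<noteq> 0\<^sub>m (dim_col Xl) (dim_col Xlt) \<and>
            \<delta>aF = sqrt ((frobenius_norm (mat_inv K * dK))\<^sup>2 + (frobenius_norm (mat_inv M * dM))\<^sup>2) \<and>
            \<delta>bF = sqrt (2 * (frobenius_norm (mat_inv M * dM))\<^sup>2
                       + (frobenius_norm (mat_inv M * dC - mat_inv M * C * mat_inv M * dM))\<^sup>2)
            \<longrightarrow> \<gamma> ^ nj * \<gamma>t ^ njt / sqrt (\<gamma>\<^sup>2 + \<gamma>t\<^sup>2)
                  \<le> 2 * (\<kappa> / frobenius_norm (mat_adjoint Xl * B * Xlt))
                      * sqrt ((real ((njt + nj - 1) choose nj))\<^sup>2 * \<delta>aF\<^sup>2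
                              + (real ((njt + nj - 1) choose njt))\<^sup>2 * \<delta>bF\<^sup>2))"
proof -
  let ?N = "2 * n"
  have small: "3 * cmod (lt - l) \<le> cmod l \<and> 3 * cmod (lt - l) \<le> cmod lt"
    if "\<gamma> \<le> (5 - sqrt 17) / 4" "\<gamma>t \<le> (5 - sqrt 17) / 4"
  proof -
    \<comment> \<open>Since (5 - 11/3) / 4 = 1/3, this is the form of the smallness condition that
      the recursion uses.\<close>
    have "11 / 3 \<le> sqrt 17" by (rule real_le_rsqrt) (simp add: power2_eq_square)
    then have "(5 - sqrt 17) / 4 \<le> 1 / 3" by simp
    then have "\<gamma> \<le> 1 / 3" "\<gamma>t \<le> 1 / 3" using that by linarith+
    then show ?thesis using l(2) lt(2) by (simp_all add: \<gamma> \<gamma>t norm_divide divide_simps)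
  qed
  define D where "D = mat_inv M * dM"
  define Z where "Z = mat_inv M * dC - mat_inv M * C * mat_inv M * dM"
  define U where "U = mat_inv K * dK"
  define WA where "WA = four_block_mat U (0\<^sub>m n n) (0\<^sub>m n n) D"
  define WB where "WB = four_block_mat D (0\<^sub>m n n) Z D"
  note lin = linearization_perturbation[OF dims nonsing(1,2), folded D_def Z_def U_def, folded WA_def WB_def]
  have carr: "A \<in> carrier_mat ?N ?N" "B \<in> carrier_mat ?N ?N"
      "WA \<in> carrier_mat ?N ?N" "WB \<in> carrier_mat ?N ?N"
    using dims lin(1-3) by (auto simp: A B WA_def WB_def)
  have At': "At = A + A * WA" unfolding At A perturbed by (fact lin(4))
  have Bt': "Bt = B + B * WB" unfolding Bt B perturbed by (fact lin(5))
  have carrt: "At \<in> carrier_mat ?N ?N" "Bt \<in> carrier_mat ?N ?N"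
    using carr by (auto simp: At' Bt')
  have hK: "hermitian_mat (- K)"
    unfolding hermitian_mat_def using dims(3) herm(3)
    by (auto simp: hermitian_mat_def hermitian_matD[OF herm(3) dims(3)] intro!: eq_matI)
  have h0: "hermitian_mat (0\<^sub>m n n)" by (auto simp: hermitian_mat_def intro!: eq_matI)
  have hA: "mat_adjoint A = A" and hB: "mat_adjoint B = B"
    unfolding A B using dims herm hK h0 by (auto intro!: hermitian_four_block)
  obtain r \<mu> where nj0: "0 < nj" and Xj: "Xs ! j \<in> carrier_mat ?N (r * nj)"
    and AXj: "A * (Xs ! j) = B * (Xs ! j) * bidiag r nj \<mu> (cmod l)"
    and \<mu>: "\<And>e. e < r \<Longrightarrow> \<mu> e \<in> {l, cnj l}"
    and BXj: "spectral_norm (B * (Xs ! j)) \<le> spectral_norm (mat_inv X)"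
    using canonical_decomposition_block_factor[OF decomp j carr(1,2) l(1,2), folded nj] by metis
  obtain rt \<nu> where njt0: "0 < njt" and Xtj: "Xts ! jt \<in> carrier_mat ?N (rt * njt)"
    and AXtj: "At * (Xts ! jt) = Bt * (Xts ! jt) * bidiag rt njt \<nu> (cmod lt)"
    and \<nu>: "\<And>e. e < rt \<Longrightarrow> \<nu> e \<in> {lt, cnj lt}"
    and nXtj: "spectral_norm (Xts ! jt) \<le> spectral_norm Xt"
    using canonical_decomposition_block_factor[OF decompt jt carrt lt(1,2), folded njt] by metis
  have \<kappa>0: "0 \<le> \<kappa>" by (simp add: \<kappa>)
  have part1: "\<gamma> \<le> \<kappa> * (\<delta>a + \<delta>b + \<delta>c) / (\<delta>d - \<kappa> * (\<delta>b + \<delta>c))"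
    if u: "u \<in> set (cols (Xs ! j))" "pair_eigenvector A B u l"
      and ut: "ut \<in> set (cols (Xts ! jt))" "pair_eigenvector At Bt ut lt"
      and x: "qep_eigenvector M C K x l" "u = x @\<^sub>v (l \<cdot>\<^sub>v x)"
      and xt: "qep_eigenvector Mt Ct Kt xt lt" "ut = xt @\<^sub>v (lt \<cdot>\<^sub>v xt)"
      and \<delta>a: "\<delta>a = max (spectral_norm U) (spectral_norm D)"
      and \<delta>b: "\<delta>b = spectral_norm D"
      and \<delta>c: "\<delta>c = spectral_norm (mat_inv M * dC) + spectral_norm (mat_inv M * C * mat_inv M * dM)"
      and \<delta>d: "\<delta>d = cmod ((C *\<^sub>v xt) \<bullet>c x + (lt + cnj l) * ((M *\<^sub>v xt) \<bullet>c x))"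
      and pos: "0 < \<delta>d - \<kappa> * (\<delta>b + \<delta>c)"
    for u ut x xt \<delta>a \<delta>b \<delta>c \<delta>d
  proof -
    have xc: "x \<in> carrier_vec n" using x(1) dims by (auto simp: qep_eigenvector_def)
    have xtc: "xt \<in> carrier_vec n" using xt(1) dims by (auto simp: qep_eigenvector_def perturbed)
    have uc: "u \<in> carrier_vec ?N"
      using xc unfolding x(2) by (intro carrier_vecI) simp
    have utc: "ut \<in> carrier_vec ?N"
      using xtc unfolding xt(2) by (intro carrier_vecI) simp
    have Au: "A *\<^sub>v u = l \<cdot>\<^sub>v (B *\<^sub>v u)" and Aut: "At *\<^sub>v ut = lt \<cdot>\<^sub>v (Bt *\<^sub>v ut)"
      using u(2) ut(2) by (auto simp: pair_eigenvector_def)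
    \<comment> \<open>A column is the image of a unit vector. This carries the bounds for
      \<open>B * (Xs ! j)\<close> and \<open>Xts ! jt\<close> over to the two eigenvectors.\<close>
    have col_norm: "vec_norm2 (col Y i) \<le> spectral_norm Y"
      if "Y \<in> carrier_mat N s" "i < s" for Y N s i
    proof -
      have "Y *\<^sub>v unit_vec s i = col Y i"
        using that by (intro eq_vecI) (auto simp: scalar_prod_right_unit)
      moreover have "vec_norm2 (unit_vec s i) = 1"
      proof -
        have "(vec_norm2 (unit_vec s i))\<^sup>2 = (\<Sum>k<s. if k = i then 1 else 0)"
          unfolding vec_norm2_power2 by (rule sum.cong) (auto simp: unit_vec_def)
        then show ?thesis using that(2) vec_norm2_nonneg[of "unit_vec s i"] by (simp add: power2_eq_1_iff)
      qed
      ultimately show ?thesis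
        using vec_norm2_mult_spectral[OF that(1), of "unit_vec s i"] by simp
    qed
    obtain i where i: "i < r * nj" "u = col (Xs ! j) i"
      using u(1) Xj by (auto simp: in_set_conv_nth)
    obtain it where it: "it < rt * njt" "ut = col (Xts ! jt) it"
      using ut(1) Xtj by (auto simp: in_set_conv_nth)
    have Bu: "B *\<^sub>v u = col (B * (Xs ! j)) i"
      using i Xj carr(2) by (intro eq_vecI) auto
    have nBu: "vec_norm2 (B *\<^sub>v u) \<le> spectral_norm (mat_inv X)"
      unfolding Bu using col_norm[OF mult_carrier_mat[OF carr(2) Xj] i(1)] BXj by linarith
    have nut: "vec_norm2 ut \<le> spectral_norm Xt"
      using col_norm[OF Xtj it(1)] nXtj by (simp add: it(2))
    have Buc: "B *\<^sub>v u \<in> carrier_vec ?N" using carr(2) uc by (rule mult_mat_vec_carrier)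
    have But: "B *\<^sub>v ut \<in> carrier_vec ?N" using carr(2) utc by (rule mult_mat_vec_carrier)
    have form: "cmod ((W *\<^sub>v ut) \<bullet>c (B *\<^sub>v u)) \<le> \<kappa> * w"
      if W: "W \<in> carrier_mat ?N ?N" "spectral_norm W \<le> w" for W w
    proof -
      have w: "0 \<le> w" using W(2) spectral_norm_nonneg[of W] by linarith
      have "cmod ((W *\<^sub>v ut) \<bullet>c (B *\<^sub>v u)) \<le> vec_norm2 (W *\<^sub>v ut) * vec_norm2 (B *\<^sub>v u)"
        by (rule Cauchy_Schwarz_vec[OF mult_mat_vec_carrier[OF W(1) utc] Buc])
      also have "\<dots> \<le> (spectral_norm W * vec_norm2 ut) * vec_norm2 (B *\<^sub>v u)"
        by (intro mult_right_mono vec_norm2_mult_spectral[OF W(1) utc]) auto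
      also have "\<dots> \<le> (w * spectral_norm Xt) * spectral_norm (mat_inv X)"
        using W(2) w nut nBu by (intro mult_mono) auto
      finally show ?thesis by (simp add: \<kappa> mult_ac)
    qed
    define \<beta> where "\<beta> = (B *\<^sub>v ut) \<bullet>c u"
    define a where "a = (WA *\<^sub>v ut) \<bullet>c (B *\<^sub>v u)"
    define b where "b = (WB *\<^sub>v ut) \<bullet>c (B *\<^sub>v u)"
    have WAut: "WA *\<^sub>v ut \<in> carrier_vec ?N" and WBut: "WB *\<^sub>v ut \<in> carrier_vec ?N"
      using carr utc by (auto intro: mult_mat_vec_carrier)
    have "spectral_norm WA \<le> \<delta>a"
      unfolding WA_def \<delta>a using lin(1,3) by (intro spectral_norm_diag_le) auto
    then have na: "cmod a \<le> \<kappa> * \<delta>a" unfolding a_def by (rule form[OF carr(3)])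
    \<comment> \<open>The triangle inequality loses the sign inside \<open>Z\<close>, hence the sum
      in \<open>\<delta>c\<close>.\<close>
    have "spectral_norm Z \<le> \<delta>c"
    proof -
      let ?S = "mat_inv M * dC" and ?T = "mat_inv M * C * mat_inv M * dM"
      note M' = mat_inv(1)[OF dims(1) nonsing(1)]
      have ST: "?S \<in> carrier_mat n n" "?T \<in> carrier_mat n n" using M' dims by auto
      have "Z = ?S + - ?T" unfolding Z_def using ST by (intro minus_add_uminus_mat) auto
      then show ?thesis
        using spectral_norm_triangle[of ?S n n "- ?T"] spectral_norm_uminus_le[of ?T n n] ST
        by (auto simp: \<delta>c)
    qed
    moreover have "spectral_norm WB \<le> \<delta>b + spectral_norm Z"
    proof -
      let ?S = "four_block_mat D (0\<^sub>m n n) (0\<^sub>m n n) D"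
        and ?T = "four_block_mat (0\<^sub>m n n) (0\<^sub>m n n) Z (0\<^sub>m n n)"
      have ST: "?S \<in> carrier_mat (n + n) (n + n)" "?T \<in> carrier_mat (n + n) (n + n)"
        using lin(1,2) by auto
      have "WB = ?S + ?T"
        unfolding WB_def using lin(1,2) by (intro eq_matI) auto
      then show ?thesis
        using spectral_norm_triangle[OF ST] spectral_norm_diag_le[OF lin(1,1), of "spectral_norm D"]
          spectral_norm_lower_le[OF lin(2)] by (auto simp: \<delta>b)
    qed
    ultimately have "spectral_norm WB \<le> \<delta>b + \<delta>c" by linarith
    then have nb: "cmod b \<le> \<kappa> * (\<delta>b + \<delta>c)" unfolding b_def by (rule form[OF carr(4)])
    have adjA: "(A *\<^sub>v w) \<bullet>c u = cnj l * (w \<bullet>c (B *\<^sub>v u))" if "w \<in> carrier_vec ?N" for w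
      using that Buc unfolding cscalar_prod_adjoint[OF carr(1) that uc] hA Au
      by (simp add: conjugate_smult_vec scalar_prod_smult_distrib[of _ ?N])
    have adjB: "(B *\<^sub>v w) \<bullet>c u = w \<bullet>c (B *\<^sub>v u)" if "w \<in> carrier_vec ?N" for w
      unfolding cscalar_prod_adjoint[OF carr(2) that uc] hB ..
    have Ws: "A * WA *\<^sub>v ut = A *\<^sub>v (WA *\<^sub>v ut)" "B * WB *\<^sub>v ut = B *\<^sub>v (WB *\<^sub>v ut)"
      using assoc_mult_mat_vec[OF carr(1,3) utc] assoc_mult_mat_vec[OF carr(2,4) utc] by auto
    have "(At *\<^sub>v ut) \<bullet>c u = (A *\<^sub>v ut) \<bullet>c u + (A *\<^sub>v (WA *\<^sub>v ut)) \<bullet>c u"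
      unfolding At' add_mult_distrib_mat_vec[OF carr(1) mult_carrier_mat[OF carr(1,3)] utc] Ws
      using carr utc uc WAut by (intro add_scalar_prod_distrib[of _ ?N] mult_mat_vec_carrier) auto
    then have 1: "(At *\<^sub>v ut) \<bullet>c u = cnj l * \<beta> + cnj l * a"
      by (simp add: adjA[OF utc] adjA[OF WAut] a_def \<beta>_def adjB[OF utc])
    have "(Bt *\<^sub>v ut) \<bullet>c u = (B *\<^sub>v ut) \<bullet>c u + (B *\<^sub>v (WB *\<^sub>v ut)) \<bullet>c u"
      unfolding Bt' add_mult_distrib_mat_vec[OF carr(2) mult_carrier_mat[OF carr(2,4)] utc] Ws
      using carr utc uc WBut by (intro add_scalar_prod_distrib[of _ ?N] mult_mat_vec_carrier) auto
    then have 2: "(Bt *\<^sub>v ut) \<bullet>c u = \<beta> + b"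
      by (simp add: adjB[OF WBut] b_def \<beta>_def)
    have "(At *\<^sub>v ut) \<bullet>c u = lt * ((Bt *\<^sub>v ut) \<bullet>c u)"
      unfolding Aut using mult_mat_vec_carrier[OF carrt(2) utc] uc
      by (simp add: smult_scalar_prod_distrib[of _ ?N])
    then have eq: "(lt - cnj l) * \<beta> = cnj l * a - lt * b"
      unfolding 1 2 by (simp add: algebra_simps)
    define t where "t = cmod (lt - cnj l)"
    have "t * cmod \<beta> \<le> cmod l * cmod a + cmod lt * cmod b"
      using norm_triangle_ineq4[of "cnj l * a" "lt * b"] arg_cong[OF eq, of cmod]
      by (simp add: norm_mult t_def)
    also have "\<dots> \<le> cmod l * (\<kappa> * \<delta>a) + (t + cmod l) * (\<kappa> * (\<delta>b + \<delta>c))"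
      using na nb norm_triangle_sub[of lt "cnj l"]
      by (intro add_mono mult_mono) (auto simp: t_def)
    finally have "t * (cmod \<beta> - \<kappa> * (\<delta>b + \<delta>c)) \<le> cmod l * (\<kappa> * (\<delta>a + \<delta>b + \<delta>c))"
      by (simp add: algebra_simps)
    moreover have "cmod \<beta> = \<delta>d"
    proof -
      have Cx: "C *\<^sub>v xt \<in> carrier_vec n" and Mx: "M *\<^sub>v xt \<in> carrier_vec n"
        using dims xtc by (auto intro: mult_mat_vec_carrier)
      have "B *\<^sub>v ut = (C *\<^sub>v xt + lt \<cdot>\<^sub>v (M *\<^sub>v xt)) @\<^sub>v (M *\<^sub>v xt)"
      proof -
        have "M *\<^sub>v (lt \<cdot>\<^sub>v xt) = lt \<cdot>\<^sub>v (M *\<^sub>v xt)" by (rule mult_mat_vec[OF dims(1) xtc])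
        moreover have "0\<^sub>m n n *\<^sub>v (lt \<cdot>\<^sub>v xt) = 0\<^sub>v n" using xtc by (intro eq_vecI) auto
        ultimately show ?thesis
          unfolding B xt(2) using dims xtc Mx
          by (subst four_block_mat_mult_vec[of _ n n _ n _ n]) auto
      qed
      moreover have "conjugate u = conjugate x @\<^sub>v (cnj l \<cdot>\<^sub>v conjugate x)"
        unfolding x(2) using xc by (intro eq_vecI) auto
      ultimately have "\<beta> = (C *\<^sub>v xt + lt \<cdot>\<^sub>v (M *\<^sub>v xt)) \<bullet>c x + (M *\<^sub>v xt) \<bullet> (cnj l \<cdot>\<^sub>v conjugate x)"
        unfolding \<beta>_def using Cx Mx xc by (simp add: scalar_prod_append[of _ n _ n])
      also have "\<dots> = (C *\<^sub>v xt) \<bullet>c x + (lt + cnj l) * ((M *\<^sub>v xt) \<bullet>c x)"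
        using Cx Mx xc by (simp add: add_scalar_prod_distrib[of _ n] smult_scalar_prod_distrib[of _ n]
            scalar_prod_smult_distrib[of _ n] algebra_simps)
      finally show ?thesis by (simp add: \<delta>d)
    qed
    moreover have "cmod (lt - l) * (\<delta>d - \<kappa> * (\<delta>b + \<delta>c)) \<le> t * (\<delta>d - \<kappa> * (\<delta>b + \<delta>c))"
      unfolding t_def using pos l(3) lt(3) by (intro mult_right_mono cmod_diff_cnj_ge) auto
    ultimately have "cmod (lt - l) * (\<delta>d - \<kappa> * (\<delta>b + \<delta>c)) \<le> cmod l * (\<kappa> * (\<delta>a + \<delta>b + \<delta>c))"
      by simp
    then show ?thesis
      using pos l(2) by (simp add: \<gamma> norm_divide pos_le_divide_eq pos_divide_le_eq mult_ac)
  qed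
  have part2: "\<gamma> ^ nj * \<gamma>t ^ njt / sqrt (\<gamma>\<^sup>2 + \<gamma>t\<^sup>2)
      \<le> 2 * (\<kappa> / frobenius_norm (mat_adjoint (Xs ! j) * B * (Xts ! jt)))
        * sqrt ((real ((njt + nj - 1) choose nj))\<^sup>2 * \<delta>aF\<^sup>2
              + (real ((njt + nj - 1) choose njt))\<^sup>2 * \<delta>bF\<^sup>2)"
    if sm: "\<gamma> \<le> (5 - sqrt 17) / 4" "\<gamma>t \<le> (5 - sqrt 17) / 4" and ne: "l \<noteq> lt"
      and Y0: "mat_adjoint (Xs ! j) * B * (Xts ! jt) \<noteq> 0\<^sub>m (dim_col (Xs ! j)) (dim_col (Xts ! jt))"
      and \<delta>aF: "\<delta>aF = sqrt ((frobenius_norm U)\<^sup>2 + (frobenius_norm D)\<^sup>2)"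
      and \<delta>bF: "\<delta>bF = sqrt (2 * (frobenius_norm D)\<^sup>2 + (frobenius_norm Z)\<^sup>2)"
    for \<delta>aF \<delta>bF
  proof -
    define s t where "s = r * nj" and "t = rt * njt"
    define J where "J = bidiag r nj \<mu> (cmod l)"
    define Jt where "Jt = bidiag rt njt \<nu> (cmod lt)"
    define V where "V = mat_adjoint (Xs ! j)"
    define W where "W = Xts ! jt"
    define VB where "VB = V * B"
    define Y where "Y = VB * W"
    define P where "P = VB * (WA * W)"
    define Q where "Q = VB * (WB * W)"
    have J: "J \<in> carrier_mat s s" "Jt \<in> carrier_mat t t" by (simp_all add: J_def Jt_def s_def t_def)
    have V: "V \<in> carrier_mat s ?N" and W: "W \<in> carrier_mat ?N t"
      using Xj Xtj by (auto simp: V_def W_def s_def t_def)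
    have VB: "VB \<in> carrier_mat s ?N" using V carr by (auto simp: VB_def)
    have WW: "WA * W \<in> carrier_mat ?N t" "WB * W \<in> carrier_mat ?N t" using carr W by auto
    have YPQ: "Y \<in> carrier_mat s t" "P \<in> carrier_mat s t" "Q \<in> carrier_mat s t"
      using VB W WW by (auto simp: Y_def P_def Q_def)
    have VB_adj: "VB = mat_adjoint (B * (Xs ! j))"
      using mat_adjoint_mult[OF carr(2) Xj] by (simp add: VB_def V_def hB)
    have VA: "V * A = mat_adjoint J * VB"
      using mat_adjoint_mult[OF carr(1) Xj] mat_adjoint_mult[OF mult_carrier_mat[OF carr(2) Xj] bidiag_carrier]
      by (simp add: V_def hA AXj J_def VB_adj)
    have nV: "spectral_norm VB \<le> spectral_norm (mat_inv X)"
      unfolding VB_adj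
      using spectral_norm_adjoint_le[OF mult_carrier_mat[OF carr(2) Xj]] BXj by linarith
    have AtW: "At * W = A * W + A * (WA * W)"
      unfolding At' add_mult_distrib_mat[OF carr(1) mult_carrier_mat[OF carr(1,3)] W]
        assoc_mult_mat[OF carr(1,3) W] ..
    have BtW: "Bt * W = B * W + B * (WB * W)"
      unfolding Bt' add_mult_distrib_mat[OF carr(2) mult_carrier_mat[OF carr(2,4)] W]
        assoc_mult_mat[OF carr(2,4) W] ..
    have "V * (At * W) = mat_adjoint J * Y + mat_adjoint J * P"
    proof -
      have "V * (At * W) = V * A * W + V * A * (WA * W)"
        unfolding AtW
          mult_add_distrib_mat[OF V mult_carrier_mat[OF carr(1) W] mult_carrier_mat[OF carr(1) WW(1)]]
          assoc_mult_mat[OF V carr(1) W] assoc_mult_mat[OF V carr(1) WW(1)] ..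
      then show ?thesis
        unfolding VA Y_def P_def assoc_mult_mat[OF mat_adjoint_carrier[OF J(1)] VB W]
          assoc_mult_mat[OF mat_adjoint_carrier[OF J(1)] VB WW(1)] .
    qed
    moreover have "V * (At * W) = Y * Jt + Q * Jt"
    proof -
      have "V * (At * W) = V * (Bt * W) * Jt"
        unfolding W_def AXtj Jt_def[symmetric]
        by (rule assoc_mult_mat[symmetric, OF V _ J(2)])
          (use mult_carrier_mat[OF carrt(2) W] in \<open>simp add: W_def\<close>)
      also have "V * (Bt * W) = Y + Q"
        unfolding BtW Y_def Q_def VB_def
          mult_add_distrib_mat[OF V mult_carrier_mat[OF carr(2) W] mult_carrier_mat[OF carr(2) WW(2)]]
          assoc_mult_mat[OF V carr(2) W] assoc_mult_mat[OF V carr(2) WW(2)] ..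
      finally show ?thesis unfolding add_mult_distrib_mat[OF YPQ(1,3) J(2)] .
    qed
    ultimately have syl: "Y * Jt + Q * Jt = mat_adjoint J * Y + mat_adjoint J * P" by simp
    have \<gamma>': "\<gamma> = cmod (lt - l) / cmod l" "\<gamma>t = cmod (lt - l) / cmod lt"
      by (simp_all add: \<gamma> \<gamma>t norm_divide)
    have \<gamma>0: "0 < \<gamma>" "0 < \<gamma>t" using ne l(2) lt(2) by (simp_all add: \<gamma>')
    define C1 where "C1 = (real ((njt + nj - 1) choose nj))\<^sup>2"
    define C2 where "C2 = (real ((njt + nj - 1) choose njt))\<^sup>2"
    have bound: "(\<gamma> ^ nj * \<gamma>t ^ njt)\<^sup>2 * (frobenius_norm Y)\<^sup>2
      \<le> 4 * (\<gamma>\<^sup>2 + \<gamma>t\<^sup>2) * (C1 * (frobenius_norm P)\<^sup>2 + C2 * (frobenius_norm Q)\<^sup>2)"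
      unfolding \<gamma>' C1_def C2_def
      using sylvester_matrix_bound[OF nj0 njt0 YPQ[unfolded s_def t_def] \<mu> \<nu> J_def Jt_def syl l(3) lt(3) ne]
        small[OF sm] by blast
    have sandwich: "frobenius_norm (VB * (G * W)) \<le> \<kappa> * frobenius_norm G"
      if G: "G \<in> carrier_mat ?N ?N" for G
    proof -
      have "frobenius_norm (VB * (G * W)) \<le> spectral_norm VB * frobenius_norm (G * W)"
        by (rule frobenius_norm_mult_left[OF VB mult_carrier_mat[OF G W]])
      also have "\<dots> \<le> spectral_norm (mat_inv X) * (frobenius_norm G * spectral_norm Xt)"
      proof (rule mult_mono[OF nV])
        have "frobenius_norm (G * W) \<le> frobenius_norm G * spectral_norm W"
          by (rule frobenius_norm_mult_right[OF G W])
        also have "\<dots> \<le> frobenius_norm G * spectral_norm Xt"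
          using nXtj by (intro mult_left_mono) (auto simp: W_def)
        finally show "frobenius_norm (G * W) \<le> frobenius_norm G * spectral_norm Xt" .
      qed auto
      finally show ?thesis by (simp add: \<kappa> mult_ac)
    qed
    have "(frobenius_norm WA)\<^sup>2 = \<delta>aF\<^sup>2" "(frobenius_norm WB)\<^sup>2 = \<delta>bF\<^sup>2"
      using lin(1-3) by (simp_all add: WA_def WB_def \<delta>aF \<delta>bF frobenius_norm_four_block[of _ n n _ n _ n]
          frobenius_norm_power2[of "0\<^sub>m n n"])
    moreover have "(frobenius_norm P)\<^sup>2 \<le> \<kappa>\<^sup>2 * (frobenius_norm WA)\<^sup>2"
      "(frobenius_norm Q)\<^sup>2 \<le> \<kappa>\<^sup>2 * (frobenius_norm WB)\<^sup>2"
      unfolding power_mult_distrib[symmetric] P_def Q_def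
      by (intro power_mono sandwich carr frobenius_norm_nonneg)+
    ultimately have PQ: "(frobenius_norm P)\<^sup>2 \<le> \<kappa>\<^sup>2 * \<delta>aF\<^sup>2" "(frobenius_norm Q)\<^sup>2 \<le> \<kappa>\<^sup>2 * \<delta>bF\<^sup>2"
      by simp_all
    define R where "R = C1 * \<delta>aF\<^sup>2 + C2 * \<delta>bF\<^sup>2"
    have R0: "0 \<le> R" by (simp add: R_def C1_def C2_def)
    have "C1 * (frobenius_norm P)\<^sup>2 + C2 * (frobenius_norm Q)\<^sup>2 \<le> C1 * (\<kappa>\<^sup>2 * \<delta>aF\<^sup>2) + C2 * (\<kappa>\<^sup>2 * \<delta>bF\<^sup>2)"
      by (intro add_mono mult_left_mono PQ) (auto simp: C1_def C2_def)
    also have "\<dots> = \<kappa>\<^sup>2 * R" by (simp add: R_def algebra_simps)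
    finally have "4 * (\<gamma>\<^sup>2 + \<gamma>t\<^sup>2) * (C1 * (frobenius_norm P)\<^sup>2 + C2 * (frobenius_norm Q)\<^sup>2)
      \<le> 4 * (\<gamma>\<^sup>2 + \<gamma>t\<^sup>2) * (\<kappa>\<^sup>2 * R)"
      by (intro mult_left_mono) auto
    with bound have "(\<gamma> ^ nj * \<gamma>t ^ njt * frobenius_norm Y)\<^sup>2 \<le> 4 * (\<gamma>\<^sup>2 + \<gamma>t\<^sup>2) * (\<kappa>\<^sup>2 * R)"
      by (simp add: power_mult_distrib)
    also have "\<dots> = (2 * sqrt (\<gamma>\<^sup>2 + \<gamma>t\<^sup>2) * \<kappa> * sqrt R)\<^sup>2"
      using R0 by (simp add: power_mult_distrib)
    finally have main: "\<gamma> ^ nj * \<gamma>t ^ njt * frobenius_norm Y \<le> 2 * sqrt (\<gamma>\<^sup>2 + \<gamma>t\<^sup>2) * \<kappa> * sqrt R"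
      by (rule power2_le_imp_le) (use \<kappa>0 R0 in simp)
    have "frobenius_norm Y \<noteq> 0"
    proof
      assume "frobenius_norm Y = 0"
      then have "Y = 0\<^sub>m s t"
        using YPQ(1) unfolding frobenius_norm_def
        by (intro eq_matI) (auto simp: L2_set_eq_0_iff)
      then show False using Y0 Xj Xtj by (simp add: Y_def VB_def V_def W_def s_def t_def)
    qed
    then have "0 < frobenius_norm Y" using frobenius_norm_nonneg[of Y] by linarith
    moreover have "0 < sqrt (\<gamma>\<^sup>2 + \<gamma>t\<^sup>2)" using \<gamma>0 by (simp add: add_pos_pos)
    ultimately have "\<gamma> ^ nj * \<gamma>t ^ njt / sqrt (\<gamma>\<^sup>2 + \<gamma>t\<^sup>2) \<le> 2 * (\<kappa> / frobenius_norm Y) * sqrt R"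
      using main by (simp add: pos_divide_le_eq pos_le_divide_eq mult_ac)
    then show ?thesis by (simp only: R_def C1_def C2_def Y_def VB_def V_def W_def)
  qed
  show ?thesis
    using part1 part2 unfolding D_def Z_def U_def by blast
qed

end
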